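(* Let $G$ be a nontrivial torsion-free compact abelian group. Then every nonempty subset of $\widehat{G}$ is ubiquitous, but no finite subset of $\widehat{G}$ is strictly positive definite.
   Context: A trigonometric polynomial on $\widehat{G}$ is a function of the form $\gamma \mapsto \sum_{i=1}^n c_i \gamma(x_i)$ with $x_i \in G$, $c_i \in \mathbb{C}$. A subset $K \subset \widehat{G}$ is strictly positive definite if the only trigonometric polynomial on $\widehat{G}$ vanishing at every point of $K$ is the identically zero function. A subset $K \subset \widehat{G}$ is ubiquitous if for every subgroup $H$ of $\widehat{G}$ of finite index and every $\gamma \in \widehat{G}$ the coset $\gamma H$ meets $K$. *)

theory Defs
  imports "HOL-Analysis.Analysis"
begin

definition character :: "('a::topological_ab_group_add \<Rightarrow> complex) \<Rightarrow> bool" where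
  "character ch \<longleftrightarrow> continuous_on UNIV ch \<and> (\<forall>x. norm (ch x) = 1) \<and>
     (\<forall>x y. ch (x + y) = ch x * ch y)"

text \<open>The dual group; its group operation is pointwise multiplication.\<close>
definition dual_group :: "('a::topological_ab_group_add \<Rightarrow> complex) set" where
  "dual_group = {ch. character ch}"

definition nsmul :: "nat \<Rightarrow> 'a::ab_group_add \<Rightarrow> 'a" where
  "nsmul n x = (\<Sum>i<n. x)"

definition torsion_free :: "'a::ab_group_add itself \<Rightarrow> bool" where
  "torsion_free _ \<longleftrightarrow> (\<forall>(x::'a) n. n > 0 \<longrightarrow> nsmul n x = 0 \<longrightarrow> x = 0)"

definition dual_subgroup :: "('a::topological_ab_group_add \<Rightarrow> complex) set \<Rightarrow> bool" where
  "dual_subgroup H \<longleftrightarrow> H \<subseteq> dual_group \<and> (\<lambda>_. 1) \<in> H \<and>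
     (\<forall>ch\<in>H. \<forall>ps\<in>H. (\<lambda>x. ch x * ps x) \<in> H) \<and>
     (\<forall>ch\<in>H. (\<lambda>x. inverse (ch x)) \<in> H)"

definition dual_coset :: "('a::topological_ab_group_add \<Rightarrow> complex) \<Rightarrow> ('a \<Rightarrow> complex) set \<Rightarrow> ('a \<Rightarrow> complex) set" where
  "dual_coset \<gamma> H = (\<lambda>h. (\<lambda>x. \<gamma> x * h x)) ` H"

definition finite_index :: "('a::topological_ab_group_add \<Rightarrow> complex) set \<Rightarrow> bool" where
  "finite_index H \<longleftrightarrow> finite ((\<lambda>\<gamma>. dual_coset \<gamma> H) ` dual_group)"

definition ubiquitous :: "('a::topological_ab_group_add \<Rightarrow> complex) set \<Rightarrow> bool" where
  "ubiquitous K \<longleftrightarrow> (\<forall>H. dual_subgroup H \<and> finite_index H \<longrightarrow>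
     (\<forall>\<gamma>\<in>dual_group. dual_coset \<gamma> H \<inter> K \<noteq> {}))"

definition trig_poly :: "('a \<times> complex) list \<Rightarrow> ('a \<Rightarrow> complex) \<Rightarrow> complex" where
  "trig_poly xs \<gamma> = (\<Sum>(x, c)\<leftarrow>xs. c * \<gamma> x)"

definition strictly_pos_def :: "('a::topological_ab_group_add \<Rightarrow> complex) set \<Rightarrow> bool" where
  "strictly_pos_def K \<longleftrightarrow> (\<forall>xs. (\<forall>\<gamma>\<in>K. trig_poly xs \<gamma> = 0) \<longrightarrow>
     (\<forall>\<gamma>\<in>dual_group. trig_poly xs \<gamma> = 0))"

end

theory Submission
  imports Defs
begin

text \<open>
  If \<open>G\<close> is torsion free then its dual is divisible, so it has no proper subgroup of finite index;
  being nontrivial it is then infinite, and finitely many characters are the zeros of a product of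
  factors \<open>\<xi> \<mapsto> \<xi> a - \<gamma> a\<close> that does not vanish at some further character.

  Divisibility and nontriviality of the dual both follow from one statement: a nonzero continuous
  positive definite \<open>f\<close> has a nonzero Fourier coefficient. Indeed, an \<open>n\<close>-th root of \<open>\<gamma>\<close> is any character
  occurring in the autocorrelation of \<open>y \<mapsto> \<integral> g (y + n x) cnj (\<gamma> x) dx\<close>, where \<open>g\<close> is concentrated near
  \<open>0\<close>; multiplication by \<open>n\<close> being injective, this function is nonzero. A nontrivial character is
  found in the autocorrelation of \<open>y \<mapsto> g (y + a) - g y\<close>. The statement on Fourier coefficients is obtained
  by two extremal problems for positive definite functions \<open>\<phi>\<close> with \<open>\<phi> 0 = 1\<close>: maximizing
  \<open>\<integral> f y \<phi> (- y) dy\<close> yields eigenfunctions of convolution with \<open>f\<close> for a positive eigenvalue, and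
  among these a function of maximal \<open>L\<^sup>2\<close> norm is a character.
\<close>

section \<open>The invariant mean\<close>

definition avg :: "'a list \<Rightarrow> ('a::ab_group_add \<Rightarrow> 'b::real_normed_vector) \<Rightarrow> 'a \<Rightarrow> 'b" where
  "avg L f x = (\<Sum>a\<leftarrow>L. f (x + a)) /\<^sub>R real (length L)"

text \<open>Von Neumann's characterization of the normalized Haar integral: the constant
  approximated uniformly by averages of finitely many translates. No measure has to be
  constructed.\<close>

definition is_mean :: "('a::ab_group_add \<Rightarrow> 'b::real_normed_vector) \<Rightarrow> 'b \<Rightarrow> bool" where
  "is_mean f m \<longleftrightarrow> (\<forall>e>0. \<exists>L. L \<noteq> [] \<and> (\<forall>x. norm (avg L f x - m) \<le> e))"

lemma is_meanE:
  assumes "is_mean f m" "e > 0"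
  obtains L where "L \<noteq> []" "\<And>x. norm (avg L f x - m) \<le> e"
  using assms unfolding is_mean_def by blast

lemma avg_bounded_linear:
  assumes "bounded_linear T"
  shows "avg L (\<lambda>x. T (f x)) x = T (avg L f x)"
proof -
  interpret bounded_linear T by fact
  have "(\<Sum>a\<leftarrow>L. T (f (x + a))) = T (\<Sum>a\<leftarrow>L. f (x + a))"
    by (induction L) (auto simp: zero add)
  then show ?thesis by (simp add: avg_def scaleR)
qed

lemma avg_add: "avg L (\<lambda>x. f x + g x) x = avg L f x + avg L g x"
  by (simp add: avg_def sum_list_addf scaleR_add_right)

lemma avg_minus_const: "L \<noteq> [] \<Longrightarrow> avg L f x - m = avg L (\<lambda>x. f x - m) x"
proof -
  have "(\<Sum>a\<leftarrow>L. f (x + a) - m) = (\<Sum>a\<leftarrow>L. f (x + a)) - real (length L) *\<^sub>R m"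
    by (induction L) (auto simp: algebra_simps)
  moreover assume "L \<noteq> []"
  ultimately show ?thesis
    by (simp add: avg_def scaleR_diff_right)
qed

lemma norm_avg_le:
  assumes "\<And>x. norm (f x) \<le> e" "L \<noteq> []"
  shows "norm (avg L f x) \<le> e"
proof -
  have "norm (\<Sum>a\<leftarrow>L. f (x + a)) \<le> real (length L) * e"
    by (induction L) (auto simp: algebra_simps intro!: norm_triangle_mono assms)
  then show ?thesis
    using assms(2) by (simp add: avg_def field_simps)
qed

lemma norm_avg_minus_le:
  assumes "\<And>x. norm (f x - m) \<le> e" "L \<noteq> []"
  shows "norm (avg L f x - m) \<le> e"
  using norm_avg_le[of "\<lambda>x. f x - m"] assms by (simp add: avg_minus_const)

lemma sum_list_scaleR: "(\<Sum>a\<leftarrow>L. c *\<^sub>R f a) = c *\<^sub>R (\<Sum>a\<leftarrow>L. f a)"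
  for f :: "'a \<Rightarrow> 'b::real_vector"
  by (induction L) (auto simp: scaleR_add_right)

text \<open>Two averaging operations commute because the group does; a double average thus inherits
  the quality of either of its two lists.\<close>

lemma avg_commute: "avg L (avg L' f) x = avg L' (avg L f) x"
proof -
  have "(\<Sum>a\<leftarrow>L. \<Sum>b\<leftarrow>L'. f (x + a + b)) = (\<Sum>b\<leftarrow>L'. \<Sum>a\<leftarrow>L. f (x + b + a))"
    by (induction L) (auto simp: sum_list_addf add_ac)
  then show ?thesis
    by (simp add: avg_def sum_list_scaleR mult.commute)
qed

lemma avg_avg: "avg L (avg L' f) x = avg (concat (map (\<lambda>a. map ((+) a) L') L)) f x"
proof -
  have "length (concat (map (\<lambda>a. map ((+) a) L') L)) = length L * length L'"
    by (induction L) auto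
  moreover have "(\<Sum>a\<leftarrow>L. \<Sum>b\<leftarrow>L'. f (x + a + b))
      = (\<Sum>c\<leftarrow>concat (map (\<lambda>a. map ((+) a) L') L). f (x + c))"
    by (induction L) (auto simp: o_def add_ac)
  ultimately show ?thesis
    by (simp add: avg_def sum_list_scaleR mult.commute)
qed

text \<open>Averaging again cannot worsen a uniform approximation of a constant. The double average
  over \<open>L\<close> and \<open>L'\<close> is therefore within \<open>e / 2\<close> of both
  \<open>m\<close> and \<open>m'\<close>.\<close>

lemma is_mean_unique:
  assumes "is_mean f m" "is_mean f m'"
  shows "m = m'"
proof -
  have "norm (m - m') \<le> e" if e: "e > 0" for e
  proof -
    obtain L where L: "L \<noteq> []" "\<And>x. norm (avg L f x - m) \<le> e / 2"
      using assms(1) e by (meson half_gt_zero is_meanE)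
    obtain L' where L': "L' \<noteq> []" "\<And>x. norm (avg L' f x - m') \<le> e / 2"
      using assms(2) e by (meson half_gt_zero is_meanE)
    have "norm (avg L' (avg L f) 0 - m) \<le> e / 2" "norm (avg L (avg L' f) 0 - m') \<le> e / 2"
      using L L' by (blast intro: norm_avg_minus_le)+
    then show ?thesis
      unfolding avg_commute[of L] by norm
  qed
  then show ?thesis
    by (metis eq_iff_diff_eq_0 field_le_epsilon add_0 norm_le_zero_iff)
qed

lemma is_mean_add:
  assumes "is_mean f m" "is_mean g k"
  shows "is_mean (\<lambda>x. f x + g x) (m + k)"
  unfolding is_mean_def
proof (intro allI impI)
  fix e :: real assume "e > 0"
  obtain L where L: "L \<noteq> []" "\<And>x. norm (avg L f x - m) \<le> e / 2"
    using assms(1) \<open>e > 0\<close> by (meson half_gt_zero is_meanE)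
  obtain L' where L': "L' \<noteq> []" "\<And>x. norm (avg L' g x - k) \<le> e / 2"
    using assms(2) \<open>e > 0\<close> by (meson half_gt_zero is_meanE)
  have "norm (avg L (avg L' (\<lambda>x. f x + g x)) x - (m + k)) \<le> e" for x
  proof -
    have "norm (avg L' (avg L f) x - m) \<le> e / 2" "norm (avg L (avg L' g) x - k) \<le> e / 2"
      using L L' by (blast intro: norm_avg_minus_le)+
    moreover have "avg L (avg L' (\<lambda>x. f x + g x)) x = avg L' (avg L f) x + avg L (avg L' g) x"
      by (simp add: avg_add[abs_def] avg_commute[of L])
    ultimately show ?thesis
      by (simp add: add_diff_add norm_triangle_le)
  qed
  then show "\<exists>L. L \<noteq> [] \<and> (\<forall>x. norm (avg L (\<lambda>x. f x + g x) x - (m + k)) \<le> e)"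
    using L(1) L'(1) unfolding avg_avg
    by (intro exI[of _ "concat (map (\<lambda>a. map ((+) a) L') L)"]) auto
qed

lemma is_mean_bounded_linear:
  assumes "bounded_linear T" "is_mean f m"
  shows "is_mean (\<lambda>x. T (f x)) (T m)"
  unfolding is_mean_def
proof (intro allI impI)
  fix e :: real assume "e > 0"
  obtain K where K: "K > 0" "\<And>x. norm (T x) \<le> norm x * K"
    using bounded_linear.pos_bounded[OF assms(1)] by blast
  obtain L where L: "L \<noteq> []" "\<And>x. norm (avg L f x - m) \<le> e / K"
    using is_meanE[OF assms(2), of "e / K"] K \<open>e > 0\<close> by auto
  have "norm (avg L (\<lambda>x. T (f x)) x - T m) \<le> e" for x
    using K(2)[of "avg L f x - m"] L(2)[of x] K(1)
    by (simp add: avg_bounded_linear[OF assms(1)] field_simps linear_diff bounded_linear.linear[OF assms(1)])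
  then show "\<exists>L. L \<noteq> [] \<and> (\<forall>x. norm (avg L (\<lambda>x. T (f x)) x - T m) \<le> e)"
    using L(1) by blast
qed

lemma is_mean_translate:
  assumes "is_mean f m" shows "is_mean (\<lambda>x. f (x + a)) m"
proof -
  have "avg L (\<lambda>x. f (x + a)) x = avg L f (x + a)" for L x
    by (simp add: avg_def add_ac)
  then show ?thesis
    using assms unfolding is_mean_def by metis
qed

lemma is_mean_uminus:
  assumes "is_mean f m" shows "is_mean (\<lambda>x. f (- x)) m"
proof -
  have "avg (map uminus L) (\<lambda>x. f (- x)) x = avg L f (- x)" for L x
    by (simp add: avg_def o_def)
  then show ?thesis
    using assms unfolding is_mean_def by (metis map_is_Nil_conv)
qed

lemma is_mean_const: "is_mean (\<lambda>x. c) c"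
  unfolding is_mean_def by (auto intro!: exI[of _ "[0]"] simp: avg_def)

lemma is_mean_norm_le:
  assumes "is_mean f m" "\<And>x. norm (f x) \<le> B"
  shows "norm m \<le> B"
proof (rule field_le_epsilon)
  fix e :: real assume "e > 0"
  then obtain L where L: "L \<noteq> []" "\<And>x. norm (avg L f x - m) \<le> e"
    using is_meanE[OF assms(1)] by blast
  then have "norm (avg L f 0) \<le> B" "norm (avg L f 0 - m) \<le> e"
    using assms(2) by (auto intro: norm_avg_le)
  then show "norm m \<le> B + e" by norm
qed

lemma is_mean_nonneg:
  fixes f :: "'a::ab_group_add \<Rightarrow> real"
  assumes "is_mean f m" "\<And>x. f x \<ge> 0"
  shows "m \<ge> 0"
proof -
  have "- m \<le> e" if e: "e > 0" for e
  proof -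
    obtain L where L: "\<And>x. norm (avg L f x - m) \<le> e"
      using is_meanE[OF assms(1) e] by blast
    have "avg L f 0 \<ge> 0"
      using assms(2) by (auto simp: avg_def intro!: sum_list_nonneg mult_nonneg_nonneg)
    then show ?thesis
      using L[of 0] by auto
  qed
  then have "- m \<le> 0" by (rule field_le_epsilon) simp
  then show ?thesis by simp
qed

section \<open>Uniformity and finite covers from compactness; existence of the mean\<close>

locale compact_ab_group =
  fixes ty :: "'a::{topological_ab_group_add,t2_space} itself"
  assumes compact_UNIV: "compact (UNIV :: 'a set)"
begin

lemma continuous_bounded:
  fixes f :: "'a \<Rightarrow> 'b::real_normed_vector"
  assumes "continuous_on UNIV f"
  obtains B where "B > 0" "\<And>x. norm (f x) \<le> B"
proof -
  have "bounded (range f)"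
    using assms compact_UNIV compact_continuous_image compact_imp_bounded by blast
  then show ?thesis
    using that by (auto simp: bounded_pos)
qed

lemma continuous_uniform_nhd:
  fixes F :: "'c::topological_space \<Rightarrow> 'a \<Rightarrow> 'b::metric_space"
  assumes "continuous_on UNIV (\<lambda>(x, t). F x t)" "e > 0"
  obtains V where "open V" "x0 \<in> V" "\<And>x t. x \<in> V \<Longrightarrow> dist (F x t) (F x0 t) \<le> e"
proof -
  have "continuous_on (UNIV \<times> UNIV) (\<lambda>(x, t). F x t)"
    using assms(1) by simp
  from continuous_on_prod_compactE[OF this compact_UNIV UNIV_I assms(2)]
  show ?thesis
    by (metis (no_types, lifting) IntI UNIV_I case_prod_conv that)
qed

text \<open>Uniform continuity with respect to translations, obtained by regarding
  \<open>f (x + v)\<close> as a family of functions of \<open>x\<close> with parameter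
  \<open>v\<close> near \<open>0\<close>.\<close>

lemma translate_uniform_nhd:
  fixes f :: "'a \<Rightarrow> 'b::metric_space"
  assumes "continuous_on UNIV f" "e > 0"
  obtains V where "open V" "0 \<in> V" "\<And>x v. v \<in> V \<Longrightarrow> dist (f (x + v)) (f x) \<le> e"
proof -
  have "continuous_on UNIV (\<lambda>(v, x). f (x + v))"
    unfolding split_beta
    by (intro continuous_on_compose2[OF assms(1)] continuous_intros) auto
  from continuous_uniform_nhd[OF this assms(2), of 0] show ?thesis
    using that by (metis add.right_neutral)
qed

lemma continuous_translate:
  fixes f :: "'a \<Rightarrow> 'b::topological_space"
  assumes "continuous_on UNIV f" shows "continuous_on UNIV (\<lambda>x. f (x + a))"
  by (rule continuous_on_compose2[OF assms]) (auto intro: continuous_on_add)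

text \<open>The preimages of \<open>V\<close> under translations form an open cover. The conclusion
  is phrased for averaging: whatever the base point \<open>z\<close>, one of the points
  \<open>z + b\<close> that enter an average falls into \<open>V\<close>.\<close>

lemma finite_translate_cover:
  assumes "open V" "v \<in> (V :: 'a set)"
  obtains L where "L \<noteq> []" "\<And>z. \<exists>b\<in>set L. z + b \<in> V"
proof -
  have "open ((\<lambda>z. z + b) -` V)" for b
    by (intro open_vimage assms continuous_intros)
  moreover have "UNIV \<subseteq> (\<Union>b\<in>UNIV. (\<lambda>z. z + b) -` V)"
  proof
    fix z
    have "z + (v - z) \<in> V" using assms by simp
    then show "z \<in> (\<Union>b\<in>UNIV. (\<lambda>z. z + b) -` V)" by blast
  qed
  ultimately obtain C where C: "finite C" "UNIV \<subseteq> (\<Union>b\<in>C. (\<lambda>z. z + b) -` V)"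
    using compactE_image[OF compact_UNIV, of UNIV "\<lambda>b. (\<lambda>z. z + b) -` V"] by metis
  obtain L where L: "set L = C"
    using C(1) finite_list by blast
  have *: "\<exists>b\<in>set L. z + b \<in> V" for z
    using C(2) unfolding L by blast
  then have "L \<noteq> []" by force
  with * show ?thesis using that by blast
qed

text \<open>Let \<open>m\<close> be the infimum of the suprema of all averages of \<open>f\<close>. All averages share the modulus of
  continuity of \<open>f\<close>, so an average which is almost optimal from above but dips below \<open>m - e\<close> does so
  on a translate of a fixed neighbourhood; averaging it again over a finite cover by such translates
  would push its supremum below \<open>m\<close>.\<close>

lemma is_mean_exists_real:
  fixes f :: "'a \<Rightarrow> real"
  assumes "continuous_on UNIV f"
  shows "\<exists>m. is_mean f m"
proof -
  obtain B where B: "\<And>x. norm (f x) \<le> B"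
    using continuous_bounded[OF assms] by blast
  define U where "U = {u. \<exists>L. L \<noteq> [] \<and> (\<forall>x. avg L f x \<le> u)}"
  define m where "m = Inf U"
  have avgB: "\<bar>avg L f x\<bar> \<le> B" if "L \<noteq> []" for L x
    using norm_avg_le[where f = f and x = x, OF _ that] B by simp
  have "avg [0] f x \<le> B" for x
    using avgB[of "[0]" x] by simp
  then have "B \<in> U" unfolding U_def by blast
  have "bdd_below U"
  proof (rule bdd_belowI)
    fix u assume "u \<in> U"
    then obtain L where "L \<noteq> []" "\<forall>x. avg L f x \<le> u" unfolding U_def by blast
    then show "- B \<le> u" using avgB[of L 0] by (smt (verit))
  qed
  have "is_mean f m"
    unfolding is_mean_def
  proof (intro allI impI)
    fix e :: real assume "e > 0"
    then have "e / 2 > 0" by simp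
    from translate_uniform_nhd[OF assms this] obtain V where V: "open V" "0 \<in> V"
      "\<And>x v. v \<in> V \<Longrightarrow> dist (f (x + v)) (f x) \<le> e / 2" by blast
    from finite_translate_cover[OF V(1,2)] obtain C
      where C: "C \<noteq> []" "\<And>z. \<exists>b\<in>set C. z + b \<in> V" by blast
    define N where "N = real (length C)"
    have "N \<ge> 1" using C(1) by (simp add: N_def Suc_le_eq)
    \<comment> \<open>Slack for the average over \<open>C\<close>: one of its \<open>N\<close> terms
      lies \<open>e / 2\<close> below \<open>m\<close>, the other \<open>N - 1\<close> exceed
      \<open>m\<close> by at most \<open>d\<close>, hence by less than \<open>e / 4\<close>
      together, so the average ends up at least \<open>e / (4 * N)\<close> below
      \<open>m\<close>.\<close>
    define d where "d = e / (4 * N)"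
    have "d > 0" using \<open>e > 0\<close> \<open>N \<ge> 1\<close> by (simp add: d_def)
    then have "Inf U < m + d" by (simp add: m_def)
    then obtain u where "u \<in> U" "u < m + d"
      using cInf_lessD[of U] \<open>B \<in> U\<close> by blast
    then obtain L where "L \<noteq> []" and Lu: "\<forall>x. avg L f x \<le> u"
      unfolding U_def by blast
    then have L: "L \<noteq> []" "avg L f x \<le> m + d" for x
      using \<open>u < m + d\<close> by (auto intro: order.trans[OF spec[OF Lu]])
    have "m - e \<le> avg L f x0" for x0
    proof (rule ccontr)
      assume x0: "\<not> m - e \<le> avg L f x0"
      let ?h = "avg L f"
      have h: "?h (x + v) \<le> ?h x + e / 2" if v: "v \<in> V" for x v
      proof -
        have "\<bar>avg L (\<lambda>x. f (x + v) - f x) x\<bar> \<le> e / 2"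
          using norm_avg_le[of "\<lambda>x. f (x + v) - f x" "e/2" L x] V(3)[OF v] L(1)
          by (simp add: dist_norm)
        moreover have "avg L (\<lambda>x. f (x + v) - f x) x = ?h (x + v) - ?h x"
          by (simp add: avg_def sum_list_subtractf add_ac right_diff_distrib)
        ultimately show ?thesis by linarith
      qed
      have "avg C ?h y \<le> m - e / (4 * N)" for y
      proof -
        obtain b where b: "b \<in> set C" "y - x0 + b \<in> V" using C(2) by blast
        then obtain C1 C2 where C12: "C = C1 @ b # C2" by (meson split_list)
        have hb: "?h (y + b) \<le> m - e / 2"
          using h[OF b(2), of x0] x0 by (simp add: algebra_simps)
        have le: "(\<Sum>a\<leftarrow>D. ?h (y + a)) \<le> length D * (m + d)" for D
        proof (induction D)
          case (Cons a D)
          then show ?case using L(2)[of "y + a"] by (simp add: ring_distribs)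
        qed simp
        have "(\<Sum>a\<leftarrow>C. ?h (y + a)) \<le> length C1 * (m + d) + (m - e/2) + length C2 * (m + d)"
          using le[of C1] le[of C2] hb by (simp add: C12)
        also have "\<dots> = N * m + (N - 1) * d - e / 2"
          unfolding N_def C12 by (simp add: algebra_simps)
        also have "\<dots> \<le> N * m - e / 4"
          using \<open>N \<ge> 1\<close> \<open>d > 0\<close> unfolding d_def by (simp add: field_simps)
        finally have "(\<Sum>a\<leftarrow>C. ?h (y + a)) / N \<le> (N * m - e / 4) / N"
          using \<open>N \<ge> 1\<close> by (intro divide_right_mono) auto
        also have "\<dots> = m - e / (4 * N)"
          using \<open>N \<ge> 1\<close> by (simp add: field_simps)
        finally show ?thesis
          unfolding avg_def[of C] N_def by (simp only: real_scaleR_def divide_inverse_commute)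
      qed
      then have "\<forall>y. avg (concat (map (\<lambda>a. map ((+) a) L) C)) f y \<le> m - e / (4 * N)"
        by (simp only: avg_avg simp_thms)
      moreover have "concat (map (\<lambda>a. map ((+) a) L) C) \<noteq> []"
        using C(1) L(1) by (cases C) auto
      ultimately have "m - e / (4 * N) \<in> U"
        unfolding U_def by blast
      then have "m \<le> m - e / (4 * N)"
        unfolding m_def using \<open>bdd_below U\<close> by (rule cInf_lower)
      then show False using \<open>e > 0\<close> \<open>N \<ge> 1\<close> by (simp add: field_simps)
    qed
    moreover have "d \<le> e"
      using \<open>e > 0\<close> \<open>N \<ge> 1\<close> by (simp add: d_def field_simps)
    ultimately have "norm (avg L f x - m) \<le> e" for x
      using L(2)[of x] by (smt (verit) real_norm_def)
    then show "\<exists>L. L \<noteq> [] \<and> (\<forall>x. norm (avg L f x - m) \<le> e)"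
      using L(1) by blast
  qed
  then show ?thesis by blast
qed

section \<open>The mean as a positive, faithful, translation invariant functional\<close>

definition mean :: "('a \<Rightarrow> complex) \<Rightarrow> complex" where
  "mean f = (THE m. is_mean f m)"

lemma mean_eqI: "is_mean f m \<Longrightarrow> mean f = m"
  unfolding mean_def by (rule the_equality) (auto intro: is_mean_unique)

lemma is_mean_mean:
  assumes "continuous_on UNIV f"
  shows "is_mean f (mean f)"
proof -
  obtain a b where "is_mean (\<lambda>x. Re (f x)) a" "is_mean (\<lambda>x. Im (f x)) b"
    using is_mean_exists_real assms continuous_on_Re continuous_on_Im by metis
  then have "is_mean (\<lambda>x. complex_of_real (Re (f x)) + \<i> * complex_of_real (Im (f x)))
      (complex_of_real a + \<i> * complex_of_real b)"
    by (intro is_mean_add is_mean_bounded_linear[of "\<lambda>y. \<i> * complex_of_real y"]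
      is_mean_bounded_linear[of complex_of_real] bounded_linear_of_real
      bounded_linear_const_mult)
  then show ?thesis
    using mean_eqI by (simp flip: complex_eq)
qed

lemma mean_add:
  "continuous_on UNIV f \<Longrightarrow> continuous_on UNIV g \<Longrightarrow> mean (\<lambda>x. f x + g x) = mean f + mean g"
  by (intro mean_eqI is_mean_add is_mean_mean)

lemma mean_cmult: "continuous_on UNIV f \<Longrightarrow> mean (\<lambda>x. c * f x) = c * mean f"
  by (intro mean_eqI is_mean_bounded_linear[of "\<lambda>x. c * x"] is_mean_mean bounded_linear_mult_right)

lemma mean_diff:
  "continuous_on UNIV f \<Longrightarrow> continuous_on UNIV g \<Longrightarrow> mean (\<lambda>x. f x - g x) = mean f - mean g"
  using mean_add[of f "\<lambda>x. - 1 * g x"] mean_cmult[of g "-1"] by (simp add: continuous_on_minus)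

lemma mean_cnj: "continuous_on UNIV f \<Longrightarrow> mean (\<lambda>x. cnj (f x)) = cnj (mean f)"
  by (intro mean_eqI is_mean_bounded_linear[of cnj] is_mean_mean bounded_linear_cnj)

lemma mean_translate: "continuous_on UNIV f \<Longrightarrow> mean (\<lambda>x. f (x + a)) = mean f"
  by (intro mean_eqI is_mean_translate is_mean_mean)

lemma mean_uminus: "continuous_on UNIV f \<Longrightarrow> mean (\<lambda>x. f (- x)) = mean f"
  by (intro mean_eqI is_mean_uminus is_mean_mean)

lemma mean_zero [simp]: "mean (\<lambda>x. 0) = 0"
  by (intro mean_eqI is_mean_const)

lemma norm_mean_le:
  "continuous_on UNIV f \<Longrightarrow> (\<And>x. norm (f x) \<le> B) \<Longrightarrow> norm (mean f) \<le> B"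
  by (rule is_mean_norm_le[OF is_mean_mean])

lemma Re_mean_nonneg:
  assumes "continuous_on UNIV f" "\<And>x. Re (f x) \<ge> 0"
  shows "Re (mean f) \<ge> 0"
  by (rule is_mean_nonneg[OF is_mean_bounded_linear[OF bounded_linear_Re is_mean_mean]]) (fact assms)+

text \<open>Faithfulness of the mean. Finitely many translates of the open set where
  \<open>Re f\<close> exceeds half its value at \<open>x0\<close> cover the group, so a sum of
  translates of \<open>f\<close> has real part at least \<open>d\<close> everywhere, and its mean is
  \<open>length L\<close> times that of \<open>f\<close>.\<close>

lemma Re_mean_pos:
  assumes f: "continuous_on UNIV f" and nn: "\<And>x. Re (f x) \<ge> 0" and pos: "Re (f x0) > 0"
  shows "Re (mean f) > 0"
proof -
  define d where "d = Re (f x0) / 2"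
  define V where "V = {x. Re (f x) > d}"
  have "open V"
    unfolding V_def by (intro open_Collect_less continuous_intros f)
  moreover have "x0 \<in> V" and "d > 0" using pos by (auto simp: V_def d_def)
  ultimately obtain L where L: "L \<noteq> []" "\<And>z. \<exists>b\<in>set L. z + b \<in> V"
    using finite_translate_cover by blast
  have cont: "continuous_on UNIV (\<lambda>x. \<Sum>a\<leftarrow>L. f (x + a))" for L
    by (induction L) (simp_all add: continuous_on_add continuous_translate[OF f])
  have mean_sum: "mean (\<lambda>x. \<Sum>a\<leftarrow>L. f (x + a)) = length L * mean f" for L
    by (induction L)
      (simp_all add: mean_add cont mean_translate[OF f] continuous_translate[OF f] ring_distribs)
  have ge: "Re (\<Sum>a\<leftarrow>L. f (x + a)) \<ge> d" for x
  proof -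
    obtain b where b: "b \<in> set L" "x + b \<in> V" using L(2) by blast
    have "Re (f (x + b)) \<le> (\<Sum>a\<leftarrow>L. Re (f (x + a)))"
      using b(1) nn by (intro member_le_sum_list) auto
    moreover have "(\<Sum>a\<leftarrow>M. Re (f (x + a))) = Re (\<Sum>a\<leftarrow>M. f (x + a))" for M
      by (induction M) auto
    ultimately show ?thesis using b(2) by (simp add: V_def)
  qed
  have "0 \<le> Re (mean (\<lambda>x. (\<Sum>a\<leftarrow>L. f (x + a)) - of_real d))"
    using ge by (intro Re_mean_nonneg) (auto intro!: continuous_intros cont)
  also have "mean (\<lambda>x. (\<Sum>a\<leftarrow>L. f (x + a)) - of_real d) = length L * mean f - of_real d"
    by (simp add: mean_diff cont mean_sum mean_eqI[OF is_mean_const])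
  finally have "d \<le> length L * Re (mean f)" by simp
  moreover have "real (length L) * Re (mean f) \<le> 0" if "Re (mean f) \<le> 0"
    using that by (intro mult_nonneg_nonpos) auto
  ultimately show ?thesis
    using \<open>d > 0\<close> by linarith
qed

lemma continuous_mean:
  fixes F :: "'c::topological_space \<Rightarrow> 'a \<Rightarrow> complex"
  assumes "continuous_on UNIV (\<lambda>(x, t). F x t)"
  shows "continuous_on UNIV (\<lambda>x. mean (F x))"
proof -
  have cF: "continuous_on UNIV (F x)" for x
  proof -
    have "continuous_on UNIV (\<lambda>t. (\<lambda>(x, t). F x t) (x, t))"
      by (intro continuous_on_compose2[OF assms] continuous_intros) auto
    then show ?thesis by simp
  qed
  have "((\<lambda>x. mean (F x)) \<longlongrightarrow> mean (F x0)) (at x0)" for x0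
  proof (rule tendstoI)
    fix e :: real assume "e > 0"
    then have "e / 2 > 0" by simp
    from continuous_uniform_nhd[OF assms this, of x0] obtain V where V: "open V" "x0 \<in> V"
      "\<And>x t. x \<in> V \<Longrightarrow> dist (F x t) (F x0 t) \<le> e / 2" by blast
    have "dist (mean (F x)) (mean (F x0)) < e" if "x \<in> V" for x
    proof -
      have "norm (mean (\<lambda>t. F x t - F x0 t)) \<le> e / 2"
        using V(3)[OF that] by (intro norm_mean_le continuous_intros cF) (simp add: dist_norm)
      then show ?thesis
        using \<open>e > 0\<close> by (simp add: mean_diff cF dist_norm)
    qed
    then show "\<forall>\<^sub>F x in at x0. dist (mean (F x)) (mean (F x0)) < e"
      using V(1,2) by (auto simp: eventually_at_topological)
  qed
  then show ?thesis
    by (simp add: continuous_on_def)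
qed

end

section \<open>Positive definite functions\<close>

lemma sum_list_cmult: "(\<Sum>p\<leftarrow>L. c * h p) = c * (\<Sum>p\<leftarrow>L. h p)" for c :: complex
  by (induction L) (auto simp: ring_distribs)

text \<open>Tychonoff's theorem: the set is a product of closed unit discs, and the topology on
  functions is that of pointwise convergence.\<close>

lemma compact_bounded_functions: "compact {\<psi> :: 'b \<Rightarrow> complex. \<forall>x. cmod (\<psi> x) \<le> 1}"
proof -
  have "{\<psi> :: 'b \<Rightarrow> complex. \<forall>x. cmod (\<psi> x) \<le> 1} = Pi\<^sub>E UNIV (\<lambda>_. cball 0 1)"
    by (auto simp: PiE_iff)
  moreover have "compactin (product_topology (\<lambda>_. euclidean) UNIV)
      (Pi\<^sub>E UNIV (\<lambda>_ :: 'b. cball (0 :: complex) 1))"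
    by (simp add: compactin_PiE)
  ultimately show ?thesis
    by (simp add: euclidean_product_topology)
qed

lemma tendsto_sum_list:
  fixes k :: "'p \<Rightarrow> complex"
  assumes "\<And>p. ((\<lambda>\<psi>. h \<psi> p) \<longlongrightarrow> k p) G"
  shows "((\<lambda>\<psi>. \<Sum>p\<leftarrow>L. h \<psi> p) \<longlongrightarrow> (\<Sum>p\<leftarrow>L. k p)) G"
  by (induction L) (auto intro: tendsto_add assms)

lemma dist_triangle_four:
  fixes a b c d :: "'m::metric_space"
  assumes "dist a b \<le> x" "dist b c \<le> y" "dist c d \<le> z" "x + y + z \<le> e"
  shows "dist a d \<le> e"
  using dist_triangle[of a d b] dist_triangle[of b d c] assms by linarith

text \<open>First-order condition at a maximum: the left side is linear in \<open>t\<close> near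
  \<open>0\<close>, the right side quadratic, so \<open>t = s * B\<close> with small
  \<open>s\<close> gives a contradiction unless \<open>B = 0\<close>.\<close>

lemma linear_term_vanishes:
  fixes B q :: real
  assumes "\<And>t. 2 * (1 + t\<^sup>2) * t * B \<le> t\<^sup>2 * q"
  shows "B = 0"
proof (rule ccontr)
  assume "B \<noteq> 0"
  define s where "s = 1 / (\<bar>q\<bar> + 1)"
  have s: "s > 0" "s * q < 1" by (auto simp: s_def field_simps abs_if)
  have "(s * B\<^sup>2) * (2 * (1 + (s * B)\<^sup>2)) \<le> (s * B\<^sup>2) * (s * q)"
    using assms[of "s * B"] by (simp add: power2_eq_square algebra_simps)
  then have "2 * (1 + (s * B)\<^sup>2) \<le> s * q"
    using s(1) \<open>B \<noteq> 0\<close> by (subst (asm) mult_le_cancel_left_pos) auto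
  with s(2) show False by (smt (verit) zero_le_power2)
qed

context compact_ab_group
begin

definition hermitian :: "('a \<Rightarrow> complex) \<Rightarrow> bool" where
  "hermitian \<phi> \<longleftrightarrow> (\<forall>x. \<phi> (- x) = cnj (\<phi> x))"

text \<open>Finite systems of weighted points are lists of pairs. Hermitian symmetry makes the
  double sum real, so taking \<open>Re\<close> loses nothing.\<close>

definition posdef :: "('a \<Rightarrow> complex) \<Rightarrow> bool" where
  "posdef \<phi> \<longleftrightarrow> hermitian \<phi> \<and>
     (\<forall>L. 0 \<le> Re (\<Sum>(c, x)\<leftarrow>L. \<Sum>(d, y)\<leftarrow>L. c * cnj d * \<phi> (x - y)))"

text \<open>The function \<open>\<Sum>\<^sub>i\<^sub>,\<^sub>j c\<^sub>i * cnj c\<^sub>j * \<phi> (x + x\<^sub>i - x\<^sub>j)\<close> for the two points \<open>0\<close>, \<open>a\<close> with weights \<open>1\<close>, \<open>c\<close>.\<close>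

definition twist :: "complex \<Rightarrow> 'a \<Rightarrow> ('a \<Rightarrow> complex) \<Rightarrow> 'a \<Rightarrow> complex" where
  "twist c a \<phi> x = (1 + c * cnj c) * \<phi> x + c * \<phi> (x + a) + cnj c * \<phi> (x - a)"

text \<open>The quadratic form of the twist on a list of weighted points is that of
  \<open>\<phi>\<close> on the longer list \<open>?L'\<close>, in which each weight \<open>d\<close>
  at \<open>y\<close> is joined by the weight \<open>d * c\<close> at \<open>y + a\<close>.\<close>

lemma posdef_twist:
  assumes "posdef \<phi>"
  shows "posdef (twist c a \<phi>)"
proof -
  have h: "\<phi> (- x) = cnj (\<phi> x)" for x
    using assms by (simp add: posdef_def hermitian_def)
  have "twist c a \<phi> (- x) = cnj (twist c a \<phi> x)" for x
  proof -
    have "- x + a = - (x - a)" "- x - a = - (x + a)"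
      by simp_all
    then show ?thesis
      unfolding twist_def h by (simp only: h) (simp add: mult.commute[of c])
  qed
  moreover have "0 \<le> Re (\<Sum>(d, x)\<leftarrow>L. \<Sum>(e, y)\<leftarrow>L. d * cnj e * twist c a \<phi> (x - y))" for L
  proof -
    let ?L' = "L @ map (\<lambda>(d, y). (d * c, y + a)) L"
    have eq: "d * cnj e * twist c a \<phi> (x - y) =
        (d * cnj e * \<phi> (x - y) + d * cnj (e * c) * \<phi> (x - (y + a))) +
        (d * c * cnj e * \<phi> (x + a - y) + d * c * cnj (e * c) * \<phi> (x + a - (y + a)))" for d e x y
      by (simp add: twist_def algebra_simps)
    have "0 \<le> Re (\<Sum>(d, x)\<leftarrow>?L'. \<Sum>(e, y)\<leftarrow>?L'. d * cnj e * \<phi> (x - y))"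
      using assms by (simp only: posdef_def)
    also have "(\<Sum>(d, x)\<leftarrow>?L'. \<Sum>(e, y)\<leftarrow>?L'. d * cnj e * \<phi> (x - y)) =
        (\<Sum>(d, x)\<leftarrow>L. \<Sum>(e, y)\<leftarrow>L. d * cnj e * twist c a \<phi> (x - y))"
      unfolding eq by (simp add: case_prod_unfold o_def sum_list_addf)
    finally show ?thesis .
  qed
  ultimately show ?thesis
    by (simp add: posdef_def hermitian_def)
qed

lemma continuous_twist:
  assumes "continuous_on UNIV \<phi>"
  shows "continuous_on UNIV (twist c a \<phi>)"
proof -
  have "continuous_on UNIV (\<lambda>x. \<phi> (x + a))" "continuous_on UNIV (\<lambda>x. \<phi> (x - a))"
    using continuous_translate[OF assms, of a] continuous_translate[OF assms, of "- a"] by simp_all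
  with assms show ?thesis
    unfolding twist_def[abs_def] by (intro continuous_intros)
qed

text \<open>If \<open>\<phi> x\<close> is nonzero, a unimodular \<open>c\<close> with
  \<open>c * \<phi> x = - cmod (\<phi> x)\<close> turns the twist at \<open>0\<close> into
  \<open>2 * \<phi> 0 - 2 * cmod (\<phi> x)\<close>. The hypothesis speaks of twists at
  \<open>0\<close> only, so that the bound also applies to the residual of an eigenvalue
  equation.\<close>

lemma hermitian_norm_le:
  assumes "hermitian \<phi>" "\<And>c a. 0 \<le> Re (twist c a \<phi> 0)"
  shows "cmod (\<phi> x) \<le> Re (\<phi> 0)"
proof (cases "\<phi> x = 0")
  case True
  then show ?thesis using assms(2)[of 0 0] by (simp add: twist_def)
next
  case False
  define c where "c = - cnj (sgn (\<phi> x))"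
  have cc: "c * cnj c = 1" and cx: "c * \<phi> x = - complex_of_real (cmod (\<phi> x))"
    using False complex_norm_square[of "\<phi> x"]
    by (auto simp: c_def sgn_eq power2_eq_square field_simps)
  have "cnj c * \<phi> (0 - x) = cnj (c * \<phi> x)"
    using assms(1) by (simp add: hermitian_def)
  then have "twist c x \<phi> 0 = 2 * \<phi> 0 - 2 * complex_of_real (cmod (\<phi> x))"
    by (simp add: twist_def cc cx)
  then show ?thesis
    using assms(2)[of c x] by simp
qed

lemma posdef_Re_nonneg:
  assumes "posdef \<phi>" shows "0 \<le> Re (\<phi> 0)"
proof -
  have "0 \<le> Re (\<Sum>(c, x)\<leftarrow>[(1, 0)]. \<Sum>(d, y)\<leftarrow>[(1, 0)]. c * cnj d * \<phi> (x - y))"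
    using assms by (simp only: posdef_def)
  then show ?thesis by simp
qed

lemma posdef_norm_le: "posdef \<phi> \<Longrightarrow> cmod (\<phi> x) \<le> Re (\<phi> 0)"
  using hermitian_norm_le posdef_Re_nonneg posdef_twist posdef_def by metis

lemma posdef_zero_real:
  assumes "posdef \<phi>" shows "\<phi> 0 = complex_of_real (Re (\<phi> 0))"
proof -
  have "\<phi> (- 0) = cnj (\<phi> 0)" using assms by (simp only: posdef_def hermitian_def)
  then show ?thesis by (simp add: complex_eq_iff)
qed

lemma posdef_scale:
  assumes "posdef \<phi>" "r \<ge> 0"
  shows "posdef (\<lambda>x. complex_of_real r * \<phi> x)"
proof -
  have "(\<Sum>(c, x)\<leftarrow>L. \<Sum>(d, y)\<leftarrow>L. c * cnj d * (complex_of_real r * \<phi> (x - y))) =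
      complex_of_real r * (\<Sum>(c, x)\<leftarrow>L. \<Sum>(d, y)\<leftarrow>L. c * cnj d * \<phi> (x - y))" for L
    by (simp only: case_prod_unfold mult.left_commute[of _ "complex_of_real r"] sum_list_cmult)
  then show ?thesis
    using assms by (simp add: posdef_def hermitian_def)
qed

section \<open>Autocorrelations\<close>

definition autocorr :: "('a \<Rightarrow> complex) \<Rightarrow> 'a \<Rightarrow> complex" where
  "autocorr g x = mean (\<lambda>y. g (x + y) * cnj (g y))"

lemma continuous_autocorr:
  assumes "continuous_on UNIV g" shows "continuous_on UNIV (autocorr g)"
proof -
  have "continuous_on UNIV (\<lambda>(x, y). g (x + y) * cnj (g y))"
    unfolding split_beta
    by (intro continuous_on_mult continuous_on_cnj continuous_on_compose2[OF assms]
        continuous_on_add continuous_on_fst continuous_on_snd continuous_on_id) auto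
  then show ?thesis
    unfolding autocorr_def[abs_def] by (rule continuous_mean)
qed

lemma mean_sum_list:
  assumes "\<And>p. continuous_on UNIV (F p)"
  shows "continuous_on UNIV (\<lambda>z. \<Sum>p\<leftarrow>L. F p z) \<and>
    mean (\<lambda>z. \<Sum>p\<leftarrow>L. F p z) = (\<Sum>p\<leftarrow>L. mean (F p))"
  by (induction L) (auto simp: assms mean_add continuous_on_add)

lemma autocorr_diff:
  assumes g: "continuous_on UNIV g"
  shows "autocorr g (x - y) = mean (\<lambda>z. g (z + x) * cnj (g (z + y)))"
proof -
  have "mean (\<lambda>z. g (x - y + z) * cnj (g z)) = mean (\<lambda>z. g (x - y + (z + y)) * cnj (g (z + y)))"
    using continuous_translate[OF g, of "x - y"] g
    by (intro mean_translate[symmetric] continuous_on_mult continuous_on_cnj) (auto simp: add.commute)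
  then show ?thesis by (simp add: autocorr_def algebra_simps)
qed

text \<open>The quadratic form on weights \<open>c\<close> at points \<open>x\<close> is the mean
  over \<open>z\<close> of the squared modulus of the sum of all
  \<open>c * g (z + x)\<close>.\<close>

lemma posdef_autocorr:
  assumes g: "continuous_on UNIV g"
  shows "posdef (autocorr g)"
proof -
  have c: "continuous_on UNIV (\<lambda>z. g (z + x) * cnj (g (z + y)))" for x y
    by (intro continuous_on_mult continuous_on_cnj continuous_translate g)
  have "autocorr g (- x) = cnj (autocorr g x)" for x
    using autocorr_diff[OF g, of 0 x] autocorr_diff[OF g, of x 0] mean_cnj[OF c[of x 0]]
    by (simp add: mult.commute)
  moreover have "0 \<le> Re (\<Sum>(c, x)\<leftarrow>L. \<Sum>(d, y)\<leftarrow>L. c * cnj d * autocorr g (x - y))" for L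
  proof -
    let ?F = "\<lambda>p q z. fst p * cnj (fst q) * (g (z + snd p) * cnj (g (z + snd q)))"
    let ?S = "\<lambda>z. \<Sum>p\<leftarrow>L. \<Sum>q\<leftarrow>L. ?F p q z"
    have cF: "continuous_on UNIV (?F p q)" for p q
      by (intro continuous_on_mult_left c)
    have 0: "continuous_on UNIV (\<lambda>z. \<Sum>q\<leftarrow>L. ?F p q z) \<and>
        mean (\<lambda>z. \<Sum>q\<leftarrow>L. ?F p q z) = (\<Sum>q\<leftarrow>L. mean (?F p q))" for p
      by (rule mean_sum_list[OF cF])
    have 1: "continuous_on UNIV ?S \<and> mean ?S = (\<Sum>p\<leftarrow>L. mean (\<lambda>z. \<Sum>q\<leftarrow>L. ?F p q z))"
      using 0 by (intro mean_sum_list) simp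
    have "?S z = (\<Sum>p\<leftarrow>L. fst p * g (z + snd p)) * cnj (\<Sum>p\<leftarrow>L. fst p * g (z + snd p))" for z
    proof -
      have cs: "cnj (\<Sum>p\<leftarrow>M. fst p * g (z + snd p)) = (\<Sum>p\<leftarrow>M. cnj (fst p * g (z + snd p)))" for M
        by (induction M) auto
      have "?S z = (\<Sum>p\<leftarrow>L. (fst p * g (z + snd p)) * (\<Sum>q\<leftarrow>L. cnj (fst q * g (z + snd q))))"
        by (simp add: mult_ac flip: sum_list_cmult)
      also have "\<dots> = (\<Sum>p\<leftarrow>L. fst p * g (z + snd p)) * (\<Sum>q\<leftarrow>L. cnj (fst q * g (z + snd q)))"
        by (simp only: mult.commute[of _ "(\<Sum>q\<leftarrow>L. cnj (fst q * g (z + snd q)))"] sum_list_cmult)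
      finally show ?thesis by (simp only: cs)
    qed
    then have "0 \<le> Re (?S z)" for z
      by (simp add: complex_mult_cnj)
    then have "0 \<le> Re (mean ?S)"
      using 1 by (intro Re_mean_nonneg) blast+
    also have "mean ?S = (\<Sum>p\<leftarrow>L. \<Sum>q\<leftarrow>L. fst p * cnj (fst q) * autocorr g (snd p - snd q))"
      using 1 0 by (simp only: autocorr_diff[OF g] mean_cmult[OF c])
    finally show ?thesis by (simp add: case_prod_unfold)
  qed
  ultimately show ?thesis by (simp add: posdef_def hermitian_def)
qed

section \<open>Convolution\<close>

definition conv :: "('a \<Rightarrow> complex) \<Rightarrow> ('a \<Rightarrow> complex) \<Rightarrow> 'a \<Rightarrow> complex" where
  "conv f \<phi> x = mean (\<lambda>y. f y * \<phi> (x - y))"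

lemma continuous_reflect:
  fixes \<phi> :: "'a \<Rightarrow> 'b::topological_space"
  assumes "continuous_on UNIV \<phi>" shows "continuous_on UNIV (\<lambda>y. \<phi> (x - y))"
  by (rule continuous_on_compose2[OF assms]) (auto intro: continuous_on_diff continuous_on_const)

lemma continuous_conv_integrand:
  "continuous_on UNIV f \<Longrightarrow> continuous_on UNIV \<phi> \<Longrightarrow> continuous_on UNIV (\<lambda>y. f y * \<phi> (x - y :: 'a))"
  for f \<phi> :: "'a \<Rightarrow> complex"
  by (intro continuous_on_mult continuous_reflect)

text \<open>Moves the dependence on \<open>x\<close> from \<open>\<phi>\<close> to \<open>f\<close>,
  so that for \<open>\<phi>\<close> bounded by \<open>1\<close> the modulus of continuity of the
  convolution is controlled by \<open>f\<close> alone.\<close>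

lemma conv_alt:
  assumes "continuous_on UNIV f" "continuous_on UNIV \<phi>"
  shows "conv f \<phi> x = mean (\<lambda>y. f (y + x) * \<phi> (- y))"
  using mean_translate[OF continuous_conv_integrand[OF assms, of x], of x]
  by (simp add: conv_def)

lemma hermitian_conv:
  assumes f: "continuous_on UNIV f" "hermitian f" and \<phi>: "continuous_on UNIV \<phi>" "hermitian \<phi>"
  shows "hermitian (conv f \<phi>)"
  unfolding hermitian_def
proof
  fix x
  have "cnj (conv f \<phi> x) = mean (\<lambda>y. cnj (f y * \<phi> (x - y)))"
    unfolding conv_def by (rule mean_cnj[symmetric, OF continuous_conv_integrand[OF f(1) \<phi>(1)]])
  also have "\<dots> = mean (\<lambda>y. f (- y) * \<phi> (- x - (- y)))"
  proof -
    have "cnj (f y * \<phi> (x - y)) = f (- y) * \<phi> (- x - (- y))" for y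
      using f(2) \<phi>(2) unfolding hermitian_def
      by (metis complex_cnj_mult minus_diff_eq minus_diff_minus)
    then show ?thesis by simp
  qed
  also have "\<dots> = conv f \<phi> (- x)"
    unfolding conv_def by (rule mean_uminus[OF continuous_conv_integrand[OF f(1) \<phi>(1)]])
  finally show "conv f \<phi> (- x) = cnj (conv f \<phi> x)" by simp
qed

text \<open>Convolution commutes with translations, and a twist is a combination of translates;
  hence twists of eigenfunctions are eigenfunctions for the same eigenvalue.\<close>

lemma conv_twist:
  assumes f: "continuous_on UNIV f" and \<phi>: "continuous_on UNIV \<phi>"
  shows "conv f (twist c a \<phi>) x = twist c a (conv f \<phi>) x"
proof -
  note ci = continuous_conv_integrand[OF f \<phi>]
  have "conv f (twist c a \<phi>) x = mean (\<lambda>y. (1 + c * cnj c) * (f y * \<phi> (x - y)) +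
      c * (f y * \<phi> (x + a - y)) + cnj c * (f y * \<phi> (x - a - y)))"
    by (simp add: conv_def twist_def algebra_simps)
  also have "\<dots> = twist c a (conv f \<phi>) x"
    by (simp add: mean_add mean_cmult ci continuous_on_mult_left continuous_on_add twist_def conv_def
        del: mult_cancel_left)
  finally show ?thesis .
qed

lemma conv_cmult:
  assumes f: "continuous_on UNIV f" and \<phi>: "continuous_on UNIV \<phi>"
  shows "conv f (\<lambda>x. c * \<phi> x) x = c * conv f \<phi> x"
  unfolding conv_def mult.left_commute[of _ c]
  by (rule mean_cmult[OF continuous_conv_integrand[OF f \<phi>]])

lemma norm_conv_diff_le:
  assumes f: "continuous_on UNIV f" and \<phi>: "continuous_on UNIV \<phi>" and \<psi>: "continuous_on UNIV \<psi>"
    and C: "\<And>x. cmod (f x) \<le> C" and e: "\<And>x. cmod (\<phi> x - \<psi> x) \<le> e"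
  shows "cmod (conv f \<phi> x - conv f \<psi> x) \<le> C * e"
proof -
  have "C \<ge> 0" using C[of 0] norm_ge_zero order.trans by blast
  have "conv f \<phi> x - conv f \<psi> x = mean (\<lambda>y. f y * (\<phi> (x - y) - \<psi> (x - y)))"
    unfolding conv_def right_diff_distrib
    by (intro mean_diff[symmetric] continuous_conv_integrand f \<phi> \<psi>)
  also have "cmod \<dots> \<le> C * e"
    using \<open>C \<ge> 0\<close>
    by (intro norm_mean_le continuous_on_mult f continuous_on_diff continuous_reflect \<phi> \<psi>)
      (auto simp: norm_mult intro!: mult_mono C e)
  finally show ?thesis .
qed

lemma norm_conv_translate_le:
  assumes f: "continuous_on UNIV f" and \<phi>: "continuous_on UNIV \<phi>" "\<And>x. cmod (\<phi> x) \<le> 1"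
    and e: "\<And>x. dist (f (x + v)) (f x) \<le> e"
  shows "cmod (conv f \<phi> (x + v) - conv f \<phi> x) \<le> e"
proof -
  have cr: "continuous_on UNIV (\<lambda>y. \<phi> (- y))"
    using continuous_reflect[OF \<phi>(1), of 0] by simp
  have "e \<ge> 0" using e[of 0] zero_le_dist order.trans by blast
  have "conv f \<phi> (x + v) - conv f \<phi> x = mean (\<lambda>y. (f (y + x + v) - f (y + x)) * \<phi> (- y))"
    unfolding conv_alt[OF f \<phi>(1)] left_diff_distrib add.assoc
    by (intro mean_diff[symmetric] continuous_on_mult continuous_translate f cr)
  also have "cmod \<dots> \<le> e"
  proof (intro norm_mean_le continuous_on_mult cr continuous_on_diff)
    show "cmod ((f (y + x + v) - f (y + x)) * \<phi> (- y)) \<le> e" for y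
      using mult_mono[of "cmod (f (y + x + v) - f (y + x))" e "cmod (\<phi> (- y))" 1] \<open>e \<ge> 0\<close>
        e[of "y + x"] \<phi>(2)[of "- y"] by (simp add: norm_mult dist_norm)
  qed (auto intro: continuous_translate f simp: add.assoc)
  finally show ?thesis .
qed

subsection \<open>Eigenfunctions of convolution operators\<close>

definition nposdef :: "('a \<Rightarrow> complex) \<Rightarrow> bool" where
  "nposdef \<phi> \<longleftrightarrow> continuous_on UNIV \<phi> \<and> posdef \<phi> \<and> \<phi> 0 = 1"

lemma nposdefD:
  assumes "nposdef \<phi>"
  shows "continuous_on UNIV \<phi>" "posdef \<phi>" "\<phi> 0 = 1" "cmod (\<phi> x) \<le> 1"
  using assms posdef_norm_le[of \<phi> x] by (auto simp: nposdef_def)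

lemma nposdef_normalize:
  assumes "continuous_on UNIV \<psi>" "posdef \<psi>" "Re (\<psi> 0) > 0"
  shows "nposdef (\<lambda>x. complex_of_real (1 / Re (\<psi> 0)) * \<psi> x)"
proof -
  have "complex_of_real (1 / Re (\<psi> 0)) * \<psi> 0 = 1"
    using assms(3) by (subst posdef_zero_real[OF assms(2)]) (simp flip: of_real_mult)
  then show ?thesis
    unfolding nposdef_def using assms
    by (intro conjI continuous_on_mult_left posdef_scale) auto
qed

text \<open>Each condition in \<open>posdef\<close> is closed and involves only finitely many
  values, so it survives a pointwise limit along any nontrivial filter. Continuity does not and is
  treated separately.\<close>

lemma posdef_limit:
  assumes "G \<noteq> bot" and lim: "\<And>x. ((\<lambda>\<psi>. \<psi> x) \<longlongrightarrow> \<phi> x) G" and ev: "eventually posdef G"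
  shows "posdef \<phi>"
proof -
  have "\<phi> (- x) = cnj (\<phi> x)" for x
  proof (rule tendsto_unique[OF \<open>G \<noteq> bot\<close> lim])
    show "((\<lambda>\<psi>. \<psi> (- x)) \<longlongrightarrow> cnj (\<phi> x)) G"
      by (rule Lim_transform_eventually[OF tendsto_cnj[OF lim]])
        (use ev in \<open>auto simp: posdef_def hermitian_def elim!: eventually_mono\<close>)
  qed
  moreover have "0 \<le> Re (\<Sum>(c, x)\<leftarrow>L. \<Sum>(d, y)\<leftarrow>L. c * cnj d * \<phi> (x - y))" for L
  proof (rule tendsto_lowerbound[OF _ _ \<open>G \<noteq> bot\<close>])
    show "((\<lambda>\<psi>. Re (\<Sum>(c, x)\<leftarrow>L. \<Sum>(d, y)\<leftarrow>L. c * cnj d * \<psi> (x - y))) \<longlongrightarrow>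
        Re (\<Sum>(c, x)\<leftarrow>L. \<Sum>(d, y)\<leftarrow>L. c * cnj d * \<phi> (x - y))) G"
      unfolding case_prod_unfold
      by (intro tendsto_Re tendsto_sum_list tendsto_mult_left lim)
    show "\<forall>\<^sub>F \<psi> in G. 0 \<le> Re (\<Sum>(c, x)\<leftarrow>L. \<Sum>(d, y)\<leftarrow>L. c * cnj d * \<psi> (x - y))"
      using ev by (rule eventually_mono) (simp only: posdef_def)
  qed
  ultimately show ?thesis by (simp add: posdef_def hermitian_def)
qed

lemma continuous_uniform_translate:
  fixes \<phi> :: "'a \<Rightarrow> 'b::metric_space"
  assumes "\<And>e. e > 0 \<Longrightarrow> \<exists>V. open V \<and> 0 \<in> V \<and> (\<forall>x. \<forall>v\<in>V. dist (\<phi> (x + v)) (\<phi> x) \<le> e)"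
  shows "continuous_on UNIV \<phi>"
proof -
  have "(\<phi> \<longlongrightarrow> \<phi> x) (at x)" for x
  proof (rule tendstoI)
    fix e :: real assume "e > 0"
    then obtain V where V: "open V" "0 \<in> V" "\<And>x v. v \<in> V \<Longrightarrow> dist (\<phi> (x + v)) (\<phi> x) \<le> e / 2"
      using assms[of "e / 2"] by auto
    have "open ((\<lambda>y. y - x) -` V)"
      by (intro open_vimage V(1) continuous_on_diff continuous_on_id continuous_on_const)
    moreover have "dist (\<phi> y) (\<phi> x) < e" if "y - x \<in> V" for y
      using V(3)[OF that, of x] \<open>e > 0\<close> by simp
    ultimately show "\<forall>\<^sub>F y in at x. dist (\<phi> y) (\<phi> x) < e"
      using V(2) unfolding eventually_at_topological
      by (intro exI[of _ "(\<lambda>y. y - x) -` V"]) auto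
  qed
  then show ?thesis by (simp add: continuous_on_def)
qed

text \<open>Convolution with \<open>f\<close> turns bounded families into equicontinuous ones; on an equicontinuous family a
  pointwise cluster point, which exists by Tychonoff's theorem, is a uniform one.\<close>

lemma approximate_eigenfunction_limit:
  assumes f: "continuous_on UNIV f" and "l > 0"
    and \<Phi>: "\<And>n. nposdef (\<Phi> n)"
    and r: "\<And>n x. cmod (complex_of_real l * \<Phi> n x - conv f (\<Phi> n) x) \<le> r n" "r \<longlonglongrightarrow> 0"
  obtains \<phi> where "nposdef \<phi>" "\<And>x. conv f \<phi> x = complex_of_real l * \<phi> x"
    "\<And>e. e > 0 \<Longrightarrow> \<exists>\<^sub>F n in sequentially. \<forall>x. cmod (\<Phi> n x - \<phi> x) \<le> e"
proof -
  define F where "F = filtermap \<Phi> sequentially"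
  have "F \<noteq> bot" by (simp add: F_def filtermap_bot_iff)
  moreover have "eventually (\<lambda>\<psi>. \<psi> \<in> {\<psi>. \<forall>x. cmod (\<psi> x) \<le> 1}) F"
    using nposdefD(4)[OF \<Phi>] by (simp add: F_def eventually_filtermap)
  ultimately obtain \<phi> where "inf (nhds \<phi>) F \<noteq> bot"
    using compact_bounded_functions[where 'b = 'a] unfolding compact_filter by blast
  \<comment> \<open>\<open>G\<close> is finer than the filter of the sequence and converges
    pointwise to \<open>\<phi>\<close>. It plays the part of a convergent subsequence, which
    compactness in the topology of pointwise convergence need not provide.\<close>
  define G where "G = inf (nhds \<phi>) F"
  have "G \<noteq> bot" using \<open>inf (nhds \<phi>) F \<noteq> bot\<close> by (simp add: G_def)
  have lim: "((\<lambda>\<psi>. \<psi> x) \<longlongrightarrow> \<phi> x) G" for x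
  proof -
    have "((\<lambda>\<psi>. \<psi> x) \<longlongrightarrow> \<phi> x) (nhds \<phi>)"
    proof (rule topological_tendstoI)
      fix S assume S: "open S" "\<phi> x \<in> S"
      have "open ((\<lambda>\<psi> :: 'a \<Rightarrow> complex. \<psi> x) -` S)"
        by (rule open_vimage[OF S(1) continuous_on_product_coordinates])
      then show "\<forall>\<^sub>F \<psi> in nhds \<phi>. \<psi> x \<in> S"
        using S(2) unfolding eventually_nhds by blast
    qed
    then show ?thesis
      by (rule tendsto_mono[rotated]) (simp add: G_def)
  qed
  have evG: "eventually P G" if "\<forall>\<^sub>F n in sequentially. P (\<Phi> n)" for P
    by (rule filter_leD[of G F]) (use that in \<open>auto simp: G_def F_def eventually_filtermap\<close>)
  have npos: "eventually nposdef G"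
    by (rule evG) (simp add: \<Phi>)
  have approx: "\<forall>\<^sub>F \<psi> in G. \<forall>x. cmod (complex_of_real l * \<psi> x - conv f \<psi> x) \<le> e" if "e > 0" for e
  proof (rule evG)
    have "\<forall>\<^sub>F n in sequentially. r n < e"
      using order_tendstoD(2)[OF r(2) that] .
    then show "\<forall>\<^sub>F n in sequentially. \<forall>x. cmod (complex_of_real l * \<Phi> n x - conv f (\<Phi> n) x) \<le> e"
      by (rule eventually_mono) (meson r(1) less_imp_le order.trans)
  qed
  \<comment> \<open>Eventually along \<open>G\<close>, \<open>l * \<psi>\<close> equals
    \<open>conv f \<psi>\<close> up to a uniformly small error. The convolution inherits the modulus
    of continuity of \<open>f\<close>, and three errors of size \<open>e * l / 3\<close> become
    \<open>e\<close> after division by \<open>l\<close>.\<close>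
  have equi: "\<exists>V. open V \<and> 0 \<in> V \<and> (\<forall>\<^sub>F \<psi> in G. \<forall>x. \<forall>v\<in>V. dist (\<psi> (x + v)) (\<psi> x) \<le> e)"
    if "e > 0" for e
  proof -
    have e3: "e * l / 3 > 0" using that \<open>l > 0\<close> by simp
    obtain V where V: "open V" "0 \<in> V" "\<And>x v. v \<in> V \<Longrightarrow> dist (f (x + v)) (f x) \<le> e * l / 3"
      using translate_uniform_nhd[OF f e3] by blast
    have "\<forall>\<^sub>F \<psi> in G. \<forall>x. \<forall>v\<in>V. dist (\<psi> (x + v)) (\<psi> x) \<le> e"
      using npos approx[OF e3]
    proof eventually_elim
      case (elim \<psi>)
      show ?case
      proof (intro allI ballI)
        fix x v assume v: "v \<in> V"
        have d2: "dist (conv f \<psi> (x + v)) (conv f \<psi> x) \<le> e * l / 3"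
          unfolding dist_norm
          by (rule norm_conv_translate_le[OF f nposdefD(1)[OF elim(1)]])
            (rule nposdefD(4)[OF elim(1)] V(3)[OF v])+
        have d1: "dist (complex_of_real l * \<psi> (x + v)) (conv f \<psi> (x + v)) \<le> e * l / 3"
          and d3: "dist (conv f \<psi> x) (complex_of_real l * \<psi> x) \<le> e * l / 3"
          using elim(2) by (simp_all add: dist_norm norm_minus_commute)
        have "dist (complex_of_real l * \<psi> (x + v)) (complex_of_real l * \<psi> x) \<le> e * l"
          by (rule dist_triangle_four[OF d1 d2 d3]) simp
        then have "l * cmod (\<psi> (x + v) - \<psi> x) \<le> l * e"
          using \<open>l > 0\<close> by (simp add: dist_norm norm_mult mult.commute flip: right_diff_distrib)
        then show "dist (\<psi> (x + v)) (\<psi> x) \<le> e"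
          using \<open>l > 0\<close> by (simp add: dist_norm)
      qed
    qed
    with V show ?thesis by blast
  qed
  have equi_lim: "dist (\<phi> (x + v)) (\<phi> x) \<le> e"
    if "\<forall>\<^sub>F \<psi> in G. \<forall>x. \<forall>v\<in>V. dist (\<psi> (x + v)) (\<psi> x) \<le> e" "v \<in> V" for V e x v
  proof (rule tendsto_upperbound[OF _ _ \<open>G \<noteq> bot\<close>])
    show "((\<lambda>\<psi>. dist (\<psi> (x + v)) (\<psi> x)) \<longlongrightarrow> dist (\<phi> (x + v)) (\<phi> x)) G"
      by (intro tendsto_dist lim)
    show "\<forall>\<^sub>F \<psi> in G. dist (\<psi> (x + v)) (\<psi> x) \<le> e"
      using that(1) by (rule eventually_mono) (use that(2) in blast)
  qed
  have cont: "continuous_on UNIV \<phi>"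
    by (rule continuous_uniform_translate) (use equi equi_lim in meson)
  \<comment> \<open>Every \<open>z\<close> differs by an element of \<open>V\<close> from one of the
    finitely many points \<open>- b\<close>, on which pointwise convergence is uniform;
    equicontinuity transfers it to \<open>z\<close>.\<close>
  have unif: "\<forall>\<^sub>F \<psi> in G. \<forall>x. cmod (\<psi> x - \<phi> x) \<le> e" if "e > 0" for e
  proof -
    have "e / 3 > 0" using that by simp
    from equi[OF this] obtain V where V: "open V" "0 \<in> V"
      and evV: "\<forall>\<^sub>F \<psi> in G. \<forall>x. \<forall>v\<in>V. dist (\<psi> (x + v)) (\<psi> x) \<le> e / 3" by blast
    obtain L where L: "\<And>z. \<exists>b\<in>set L. z + b \<in> V"
      using finite_translate_cover[OF V] by blast
    have "\<forall>\<^sub>F \<psi> in G. \<forall>b\<in>set L. dist (\<psi> (- b)) (\<phi> (- b)) < e / 3"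
      using tendstoD[OF lim \<open>e / 3 > 0\<close>] by (simp add: eventually_ball_finite_distrib)
    then show ?thesis
      using evV
    proof eventually_elim
      case (elim \<psi>)
      show ?case
      proof
        fix z
        obtain b where b: "b \<in> set L" "z + b \<in> V" using L by blast
        have d1: "dist (\<psi> z) (\<psi> (- b)) \<le> e / 3" and d3: "dist (\<phi> (- b)) (\<phi> z) \<le> e / 3"
          using bspec[OF spec[OF elim(2), of "- b"] b(2)] equi_lim[OF evV b(2), of "- b"]
          by (simp_all add: dist_commute)
        have d2: "dist (\<psi> (- b)) (\<phi> (- b)) \<le> e / 3"
          using elim(1) b(1) less_imp_le by blast
        have "dist (\<psi> z) (\<phi> z) \<le> e"
          by (rule dist_triangle_four[OF d1 d2 d3]) simp
        then show "cmod (\<psi> z - \<phi> z) \<le> e" by (simp add: dist_norm)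
      qed
    qed
  qed
  have "\<phi> 0 = 1"
  proof (rule tendsto_unique[OF \<open>G \<noteq> bot\<close> lim])
    show "((\<lambda>\<psi>. \<psi> 0) \<longlongrightarrow> 1) G"
      by (rule tendsto_eventually) (use npos in \<open>auto simp: nposdef_def elim: eventually_mono\<close>)
  qed
  moreover have "posdef \<phi>"
    by (rule posdef_limit[OF \<open>G \<noteq> bot\<close> lim]) (use npos in \<open>auto simp: nposdef_def elim: eventually_mono\<close>)
  ultimately have "nposdef \<phi>" using cont by (simp add: nposdef_def)
  moreover have "conv f \<phi> x = complex_of_real l * \<phi> x" for x
  proof -
    obtain C where C: "C > 0" "\<And>x. cmod (f x) \<le> C"
      using continuous_bounded[OF f] by blast
    have "cmod (complex_of_real l * \<phi> x - conv f \<phi> x) \<le> e" if "e > 0" for e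
    proof -
      \<comment> \<open>Three errors are added below: \<open>l * d\<close> from replacing
        \<open>\<phi>\<close> by \<open>\<psi>\<close>, \<open>d\<close> from the approximate
        equation and \<open>C * d\<close> from the convolution.\<close>
      define d where "d = e / (l + 1 + C)"
      have "d > 0" using that C(1) \<open>l > 0\<close> by (simp add: d_def)
      have "\<exists>\<psi>. nposdef \<psi> \<and> (\<forall>x. cmod (\<psi> x - \<phi> x) \<le> d) \<and>
          (\<forall>x. cmod (complex_of_real l * \<psi> x - conv f \<psi> x) \<le> d)"
        using eventually_conj[OF npos eventually_conj[OF unif[OF \<open>d > 0\<close>] approx[OF \<open>d > 0\<close>]]]
        by (rule eventually_happens'[OF \<open>G \<noteq> bot\<close>])
      then obtain \<psi> where \<psi>: "nposdef \<psi>" "\<And>x. cmod (\<psi> x - \<phi> x) \<le> d"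
        "\<And>x. cmod (complex_of_real l * \<psi> x - conv f \<psi> x) \<le> d" by blast
      have 1: "cmod (conv f \<psi> x - conv f \<phi> x) \<le> C * d"
        by (rule norm_conv_diff_le[OF f nposdefD(1)[OF \<psi>(1)] cont C(2) \<psi>(2)])
      have "cmod (complex_of_real l * (\<psi> x - \<phi> x)) \<le> l * d"
        using \<psi>(2) \<open>l > 0\<close> by (simp add: norm_mult)
      then have 2: "cmod (complex_of_real l * \<psi> x - complex_of_real l * \<phi> x) \<le> l * d"
        by (simp only: right_diff_distrib)
      have "dist (complex_of_real l * \<phi> x) (conv f \<phi> x) \<le> l * d + d + C * d"
        by (rule dist_triangle_four[of _ "complex_of_real l * \<psi> x" "l * d" "conv f \<psi> x" d _ "C * d"])
          (use 1 2 \<psi>(3)[of x] in \<open>simp_all add: dist_norm norm_minus_commute\<close>)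
      also have "\<dots> = d * (l + 1 + C)" by (simp add: algebra_simps)
      also have "\<dots> = e" using \<open>l > 0\<close> C(1) by (simp add: d_def)
      finally show ?thesis by (simp add: dist_norm)
    qed
    then have "cmod (complex_of_real l * \<phi> x - conv f \<phi> x) \<le> 0"
      by (intro field_le_epsilon[of _ 0]) simp
    then show ?thesis by simp
  qed
  \<comment> \<open>\<open>G\<close> only clusters along the sequence, so closeness to
    \<open>\<phi>\<close> is obtained for infinitely many \<open>n\<close>; this suffices for
    comparing suprema.\<close>
  moreover have "\<exists>\<^sub>F n in sequentially. \<forall>x. cmod (\<Phi> n x - \<phi> x) \<le> e" if "e > 0" for e
  proof (rule ccontr)
    assume "\<not> (\<exists>\<^sub>F n in sequentially. \<forall>x. cmod (\<Phi> n x - \<phi> x) \<le> e)"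
    then have "\<forall>\<^sub>F \<psi> in G. \<not> (\<forall>x. cmod (\<psi> x - \<phi> x) \<le> e)"
      by (intro evG) (simp only: not_frequently)
    with unif[OF that] have "\<forall>\<^sub>F \<psi> in G. False"
      by eventually_elim blast
    then show False using \<open>G \<noteq> bot\<close> by (simp add: eventually_False)
  qed
  ultimately show ?thesis using that by blast
qed

text \<open>\<open>l\<close> is the supremum of \<open>Re (conv f \<phi> 0)\<close> over normalized
  positive definite \<open>\<phi>\<close>. The residual of the eigenvalue equation is bounded by the
  distance from this supremum, so a maximizing sequence consists of approximate
  eigenfunctions.\<close>

lemma eigenfunction_exists:
  assumes f: "continuous_on UNIV f" "posdef f" "f 0 \<noteq> 0"
  obtains l \<phi> where "l > 0" "nposdef \<phi>" "\<And>x. conv f \<phi> x = complex_of_real l * \<phi> x"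
proof -
  obtain C where C: "C > 0" "\<And>x. cmod (f x) \<le> C"
    using continuous_bounded[OF f(1)] by blast
  define S where "S = {Re (conv f \<phi> 0) |\<phi>. nposdef \<phi>}"
  define l where "l = Sup S"
  have bdd: "bdd_above S"
  proof (rule bdd_aboveI)
    fix s assume "s \<in> S"
    then obtain \<phi> where \<phi>: "nposdef \<phi>" "s = Re (conv f \<phi> 0)" by (auto simp: S_def)
    have "cmod (conv f \<phi> 0) \<le> C"
      unfolding conv_def
    proof (rule norm_mean_le[OF continuous_conv_integrand[OF f(1) nposdefD(1)[OF \<phi>(1)]]])
      show "cmod (f y * \<phi> (0 - y)) \<le> C" for y
        using mult_mono[OF C(2)[of y] nposdefD(4)[OF \<phi>(1), of "0 - y"]] C(1) by (simp add: norm_mult)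
    qed
    then show "s \<le> C" using complex_Re_le_cmod[of "conv f \<phi> 0"] \<phi>(2) by linarith
  qed
  have f0: "Re (f 0) > 0"
    using posdef_Re_nonneg[OF f(2)] posdef_zero_real[OF f(2)] f(3)
    by (metis less_eq_real_def of_real_0)
  note n0 = nposdef_normalize[OF f(1,2) f0]
  \<comment> \<open>The normalized \<open>f\<close> is itself a competitor: \<open>f\<close> being
    hermitian, \<open>conv f f 0\<close> is the mean of its squared modulus. Hence the supremum is
    positive.\<close>
  have "Re (conv f (\<lambda>x. complex_of_real (1 / Re (f 0)) * f x) 0) > 0"
  proof -
    have "f y * f (0 - y) = complex_of_real ((cmod (f y))\<^sup>2)" for y
      using f(2) by (simp add: posdef_def hermitian_def complex_norm_square del: of_real_power)
    then have "conv f f 0 = mean (\<lambda>y. complex_of_real ((cmod (f y))\<^sup>2))"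
      by (simp only: conv_def)
    also have "0 < Re \<dots>"
      using f(3) by (intro Re_mean_pos[of _ 0] continuous_intros f(1)) auto
    finally have "0 < Re (conv f f 0)" .
    then show ?thesis
      using f0 unfolding conv_cmult[OF f(1) f(1)] by simp
  qed
  moreover have "Re (conv f (\<lambda>x. complex_of_real (1 / Re (f 0)) * f x) 0) \<le> l"
    unfolding l_def using n0 by (intro cSup_upper bdd) (auto simp: S_def)
  ultimately have "l > 0" by linarith
  have le: "Re (conv f \<psi> 0) \<le> l * Re (\<psi> 0)" if \<psi>: "continuous_on UNIV \<psi>" "posdef \<psi>" for \<psi>
  proof (cases "Re (\<psi> 0) = 0")
    case True
    then have "\<psi> x = 0" for x using posdef_norm_le[OF \<psi>(2), of x] by simp
    then show ?thesis by (simp add: conv_def)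
  next
    case False
    then have pos: "Re (\<psi> 0) > 0" using posdef_Re_nonneg[OF \<psi>(2)] by simp
    have "Re (conv f (\<lambda>x. complex_of_real (1 / Re (\<psi> 0)) * \<psi> x) 0) \<le> l"
      unfolding l_def using nposdef_normalize[OF \<psi> pos] by (intro cSup_upper bdd) (auto simp: S_def)
    then show ?thesis
      unfolding conv_cmult[OF f(1) \<psi>(1)] using pos by (simp add: field_simps)
  qed
  \<comment> \<open>By \<open>le\<close>, \<open>l * \<psi> 0 - conv f \<psi> 0\<close> has
    nonnegative real part for continuous positive definite \<open>\<psi>\<close>. Applied to the
    twists of \<open>\<phi>\<close>, this is the hypothesis of \<open>hermitian_norm_le\<close> for
    the residual, whose modulus is thus largest at \<open>0\<close>.\<close>
  have bound: "cmod (complex_of_real l * \<phi> x - conv f \<phi> x) \<le> l - Re (conv f \<phi> 0)"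
    if \<phi>: "nposdef \<phi>" for \<phi> x
  proof -
    let ?R = "\<lambda>x. complex_of_real l * \<phi> x - conv f \<phi> x"
    have "hermitian (conv f \<phi>)" "hermitian \<phi>"
      using hermitian_conv[of f \<phi>] f \<phi> by (auto simp: nposdef_def posdef_def)
    then have "hermitian ?R" by (simp add: hermitian_def)
    moreover have "0 \<le> Re (twist c a ?R 0)" for c a
    proof -
      have "twist c a ?R 0 = complex_of_real l * twist c a \<phi> 0 - twist c a (conv f \<phi>) 0"
        by (simp add: twist_def algebra_simps)
      also have "\<dots> = complex_of_real l * twist c a \<phi> 0 - conv f (twist c a \<phi>) 0"
        by (simp add: conv_twist[OF f(1) nposdefD(1)[OF \<phi>]])
      finally show ?thesis
        using le[OF continuous_twist posdef_twist] nposdefD(1,2)[OF \<phi>] by simp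
    qed
    ultimately have "cmod (?R x) \<le> Re (?R 0)" by (rule hermitian_norm_le)
    then show ?thesis using nposdefD(3)[OF \<phi>] by simp
  qed
  have "\<exists>\<phi>. nposdef \<phi> \<and> l - 1 / real (Suc n) < Re (conv f \<phi> 0)" for n
  proof -
    have "S \<noteq> {}" using n0 by (auto simp: S_def)
    then have "\<exists>s\<in>S. l - 1 / real (Suc n) < s"
      using bdd by (subst less_cSup_iff[symmetric]) (auto simp: l_def)
    then show ?thesis by (auto simp: S_def)
  qed
  then obtain \<Phi> where \<Phi>: "\<And>n. nposdef (\<Phi> n)" "\<And>n. l - 1 / real (Suc n) < Re (conv f (\<Phi> n) 0)"
    by metis
  have r: "cmod (complex_of_real l * \<Phi> n x - conv f (\<Phi> n) x) \<le> 1 / real (Suc n)" for n x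
    using bound[OF \<Phi>(1)[of n], of x] \<Phi>(2)[of n] by linarith
  have "(\<lambda>n. 1 / real (Suc n)) \<longlonglongrightarrow> 0"
    using LIMSEQ_inverse_real_of_nat by (simp add: inverse_eq_divide)
  then show ?thesis
  proof (rule approximate_eigenfunction_limit[where \<Phi> = \<Phi> and r = "\<lambda>n. 1 / real (Suc n)",
        OF f(1) \<open>l > 0\<close> \<Phi>(1) r])
    fix \<phi> assume "nposdef \<phi>" "\<And>x. conv f \<phi> x = complex_of_real l * \<phi> x"
    then show ?thesis by (rule that[OF \<open>l > 0\<close>])
  qed
qed

section \<open>The \<open>L\<^sup>2\<close> norm and extremal eigenfunctions\<close>

definition sqnorm :: "('a \<Rightarrow> complex) \<Rightarrow> real" where
  "sqnorm \<phi> = Re (mean (\<lambda>x. \<phi> x * cnj (\<phi> x)))"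

lemma sqnorm_add:
  assumes u: "continuous_on UNIV u" and v: "continuous_on UNIV v"
  shows "sqnorm (\<lambda>x. complex_of_real a * u x + complex_of_real b * v x) =
    a\<^sup>2 * sqnorm u + 2 * a * b * Re (mean (\<lambda>x. u x * cnj (v x))) + b\<^sup>2 * sqnorm v"
proof -
  let ?a = "complex_of_real a" and ?b = "complex_of_real b"
  have c: "continuous_on UNIV (\<lambda>x. w x * cnj (z x))"
    if "continuous_on UNIV w" "continuous_on UNIV z" for w z :: "'a \<Rightarrow> complex"
    by (intro continuous_on_mult continuous_on_cnj that)
  have "mean (\<lambda>x. (?a * u x + ?b * v x) * cnj (?a * u x + ?b * v x)) =
      mean (\<lambda>x. (?a * ?a) * (u x * cnj (u x)) + (?a * ?b) * (u x * cnj (v x))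
        + ((?a * ?b) * (v x * cnj (u x)) + (?b * ?b) * (v x * cnj (v x))))"
    by (rule arg_cong[where f = mean]) (simp add: fun_eq_iff algebra_simps)
  also have "\<dots> = (?a * ?a) * mean (\<lambda>x. u x * cnj (u x)) + (?a * ?b) * mean (\<lambda>x. u x * cnj (v x))
      + ((?a * ?b) * mean (\<lambda>x. v x * cnj (u x)) + (?b * ?b) * mean (\<lambda>x. v x * cnj (v x)))"
    by (simp only: mean_add mean_cmult continuous_on_add continuous_on_mult_left c u v)
  also have "mean (\<lambda>x. v x * cnj (u x)) = cnj (mean (\<lambda>x. u x * cnj (v x)))"
    using mean_cnj[OF c[OF u v]] by (simp add: mult.commute)
  finally show ?thesis
    by (simp add: sqnorm_def power2_eq_square algebra_simps flip: of_real_mult)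
qed

lemma sqnorm_eq_zero:
  assumes "continuous_on UNIV u" "sqnorm u \<le> 0"
  shows "u x = 0"
proof (rule ccontr)
  assume "u x \<noteq> 0"
  then have "0 < Re (mean (\<lambda>x. complex_of_real ((cmod (u x))\<^sup>2)))"
    by (intro Re_mean_pos[of _ x] continuous_intros assms(1)) auto
  then show False
    using assms(2) unfolding sqnorm_def by (simp only: complex_norm_square)
qed

lemma sqnorm_diff_le:
  assumes u: "continuous_on UNIV u" "\<And>x. cmod (u x) \<le> 1"
    and v: "continuous_on UNIV v" "\<And>x. cmod (v x) \<le> 1"
    and e: "\<And>x. cmod (u x - v x) \<le> e"
  shows "sqnorm u \<le> sqnorm v + 2 * e"
proof -
  have "e \<ge> 0" using e[of 0] norm_ge_zero order.trans by blast
  have c: "continuous_on UNIV (\<lambda>x. u x * cnj (u x))" "continuous_on UNIV (\<lambda>x. v x * cnj (v x))"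
    by (intro continuous_on_mult continuous_on_cnj u v)+
  have "cmod (u x * cnj (u x) - v x * cnj (v x)) \<le> 2 * e" for x
  proof -
    have "u x * cnj (u x) - v x * cnj (v x) = (u x - v x) * cnj (u x) + v x * cnj (u x - v x)"
      by (simp add: algebra_simps)
    also have "cmod \<dots> \<le> cmod (u x - v x) * cmod (u x) + cmod (v x) * cmod (u x - v x)"
      by (metis norm_triangle_ineq norm_mult complex_mod_cnj)
    also have "\<dots> \<le> e * 1 + 1 * e"
      using \<open>e \<ge> 0\<close> by (intro add_mono mult_mono e u(2) v(2)) auto
    finally show ?thesis by simp
  qed
  then have "cmod (mean (\<lambda>x. u x * cnj (u x) - v x * cnj (v x))) \<le> 2 * e"
    by (intro norm_mean_le continuous_on_diff c)
  then show ?thesis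
    using complex_Re_le_cmod[of "mean (\<lambda>x. u x * cnj (u x) - v x * cnj (v x))"]
    by (simp add: sqnorm_def mean_diff c)
qed

lemma sqnorm_le_one:
  assumes "continuous_on UNIV u" "\<And>x. cmod (u x) \<le> 1"
  shows "sqnorm u \<le> 1"
proof -
  have "cmod (mean (\<lambda>x. u x * cnj (u x))) \<le> 1"
    using assms(2) by (intro norm_mean_le continuous_on_mult continuous_on_cnj assms(1))
      (simp add: norm_mult mult_le_one)
  then show ?thesis
    using complex_Re_le_cmod[of "mean (\<lambda>x. u x * cnj (u x))"] unfolding sqnorm_def by linarith
qed

text \<open>Multiplicativity and hermitian symmetry give
  \<open>\<phi> x * cnj (\<phi> x) = \<phi> 0 = 1\<close>, so the values are unimodular.\<close>

lemma posdef_multiplicative_character: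
  assumes "nposdef \<phi>" "\<And>x a. \<phi> (x + a) = \<phi> a * \<phi> x"
  shows "character \<phi>"
proof -
  have "cmod (\<phi> x) = 1" for x
  proof -
    have "\<phi> x * cnj (\<phi> x) = \<phi> (- x + x)"
      using assms(2)[of "- x" x] nposdefD(2)[OF assms(1)] by (simp only: posdef_def hermitian_def)
    then have "complex_of_real ((cmod (\<phi> x))\<^sup>2) = 1"
      using nposdefD(3)[OF assms(1)] by (simp add: complex_norm_square del: of_real_power)
    then show ?thesis
      using norm_ge_zero by (metis of_real_eq_1_iff power2_eq_1_iff le_minus_one_simps(3))
  qed
  then show ?thesis
    using assms nposdefD(1)[OF assms(1)] by (simp add: character_def mult.commute)
qed

text \<open>Among the normalized positive definite eigenfunctions take one of maximal \<open>L\<^sup>2\<close> norm. By strict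
  convexity it is extremal, so each of its twists, being again a positive definite eigenfunction, is
  a multiple of it; this is the functional equation of a character.\<close>

lemma character_exists:
  assumes f: "continuous_on UNIV f" "posdef f" "f 0 \<noteq> 0"
  obtains \<gamma> where "character \<gamma>" "mean (\<lambda>y. f y * \<gamma> (- y)) \<noteq> 0"
proof -
  obtain l \<phi>0 where "l > 0" and \<phi>0: "nposdef \<phi>0" "\<And>x. conv f \<phi>0 x = complex_of_real l * \<phi>0 x"
    using eigenfunction_exists[OF f] by blast
  define eig where "eig \<phi> \<longleftrightarrow> (\<forall>x. conv f \<phi> x = complex_of_real l * \<phi> x)" for \<phi>
  define S where "S = {sqnorm \<phi> |\<phi>. nposdef \<phi> \<and> eig \<phi>}"
  define s where "s = Sup S"
  have "S \<noteq> {}" using \<phi>0 by (auto simp: S_def eig_def)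
  have bdd: "bdd_above S"
    by (rule bdd_aboveI[of _ 1]) (auto simp: S_def intro!: sqnorm_le_one nposdefD)
  have "\<exists>\<phi>. nposdef \<phi> \<and> eig \<phi> \<and> s - 1 / real (Suc n) < sqnorm \<phi>" for n
  proof -
    have "\<exists>t\<in>S. s - 1 / real (Suc n) < t"
      using bdd \<open>S \<noteq> {}\<close> by (subst less_cSup_iff[symmetric]) (auto simp: s_def)
    then show ?thesis by (auto simp: S_def)
  qed
  then obtain \<Phi> where \<Phi>: "\<And>n. nposdef (\<Phi> n)" "\<And>n. eig (\<Phi> n)"
      "\<And>n. s - 1 / real (Suc n) < sqnorm (\<Phi> n)"
    by metis
  \<comment> \<open>The sequence consists of exact eigenfunctions, so the error bound is
    \<open>0\<close>; what the limit lemma contributes is a uniform cluster point, to which the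
    values of \<open>sqnorm\<close> carry over.\<close>
  have r: "cmod (complex_of_real l * \<Phi> n x - conv f (\<Phi> n) x) \<le> 0" for n x
    using \<Phi>(2) by (simp add: eig_def)
  obtain \<phi> where \<phi>: "nposdef \<phi>" "\<And>x. conv f \<phi> x = complex_of_real l * \<phi> x"
    and freq: "\<And>e. e > 0 \<Longrightarrow> \<exists>\<^sub>F n in sequentially. \<forall>x. cmod (\<Phi> n x - \<phi> x) \<le> e"
    using approximate_eigenfunction_limit[where \<Phi> = \<Phi> and r = "\<lambda>_. 0",
        OF f(1) \<open>l > 0\<close> \<Phi>(1) r tendsto_const]
    by blast
  note c\<phi> = nposdefD(1)[OF \<phi>(1)]
  have "s \<le> sqnorm \<phi>"
  proof (rule field_le_epsilon)
    fix e :: real assume "e > 0"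
    then have "e / 4 > 0" by simp
    obtain N where N: "1 / real (Suc N) < e / 2"
      using nat_approx_posE[of "e / 2"] \<open>e > 0\<close> by auto
    have "\<exists>n\<ge>N. \<forall>x. cmod (\<Phi> n x - \<phi> x) \<le> e / 4"
      using freq[OF \<open>e / 4 > 0\<close>] unfolding frequently_sequentially by blast
    then obtain n where n: "n \<ge> N" "\<And>x. cmod (\<Phi> n x - \<phi> x) \<le> e / 4" by blast
    have "sqnorm (\<Phi> n) \<le> sqnorm \<phi> + 2 * (e / 4)"
      by (rule sqnorm_diff_le) (rule nposdefD[OF \<Phi>(1)] nposdefD[OF \<phi>(1)] n(2))+
    moreover have "1 / real (Suc n) \<le> 1 / real (Suc N)"
      using n(1) by (simp add: frac_le)
    ultimately show "s \<le> sqnorm \<phi> + e"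
      using \<Phi>(3)[of n] N by linarith
  qed
  moreover have "sqnorm \<phi> \<le> s"
    unfolding s_def using \<phi> bdd by (intro cSup_upper) (auto simp: S_def eig_def)
  ultimately have s: "sqnorm \<phi> = s" by simp
  have max: "sqnorm \<psi> \<le> s * (Re (\<psi> 0))\<^sup>2"
    if \<psi>: "continuous_on UNIV \<psi>" "posdef \<psi>" "eig \<psi>" for \<psi>
  proof (cases "Re (\<psi> 0) = 0")
    case True
    then have "\<psi> x = 0" for x using posdef_norm_le[OF \<psi>(2), of x] by simp
    then show ?thesis using True by (simp add: sqnorm_def)
  next
    case False
    define t where "t = 1 / Re (\<psi> 0)"
    have pos: "Re (\<psi> 0) > 0" using posdef_Re_nonneg[OF \<psi>(2)] False by simp
    have "eig (\<lambda>x. complex_of_real t * \<psi> x)"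
      using \<psi>(3) conv_cmult[OF f(1) \<psi>(1)] by (simp add: eig_def mult.left_commute)
    then have "sqnorm (\<lambda>x. complex_of_real t * \<psi> x) \<le> s"
      unfolding s_def using nposdef_normalize[OF \<psi>(1,2) pos] bdd
      by (intro cSup_upper) (auto simp: S_def t_def)
    moreover have "sqnorm (\<lambda>x. complex_of_real t * \<psi> x) = t\<^sup>2 * sqnorm \<psi>"
      using sqnorm_add[OF \<psi>(1) \<psi>(1), of t 0] by simp
    ultimately have "t\<^sup>2 * sqnorm \<psi> \<le> s" by (simp only:)
    then show ?thesis using pos by (simp add: t_def field_simps)
  qed
  \<comment> \<open>The twist of \<open>\<phi>\<close> by \<open>t * c\<close> is
    \<open>(1 + t^2) * \<phi> + t * d\<close>, where \<open>d\<close> is the left-hand side.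
    Maximality for all real \<open>t\<close> forces \<open>d\<close> to be \<open>\<delta>\<close>
    times \<open>\<phi>\<close>.\<close>
  have key: "c * \<phi> (x + a) + cnj c * \<phi> (x - a) = complex_of_real (2 * Re (c * \<phi> a)) * \<phi> x"
    if c: "c * cnj c = 1" for c a x
  proof -
    define d where "d x = c * \<phi> (x + a) + cnj c * \<phi> (x - a)" for x
    define \<delta> where "\<delta> = 2 * Re (c * \<phi> a)"
    have "continuous_on UNIV (\<lambda>x. \<phi> (x - a))"
      using continuous_translate[OF c\<phi>, of "- a"] by simp
    then have cd: "continuous_on UNIV d"
      unfolding d_def[abs_def] by (intro continuous_intros continuous_translate c\<phi>)
    have d0: "Re (d 0) = \<delta>"
      using nposdefD(2)[OF \<phi>(1)] by (simp add: d_def \<delta>_def posdef_def hermitian_def)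
    define A where "A = Re (mean (\<lambda>x. \<phi> x * cnj (d x)))"
    have ineq: "2 * (1 + t\<^sup>2) * t * (A - s * \<delta>) \<le> t\<^sup>2 * (s * \<delta>\<^sup>2 - sqnorm d)" for t
    proof -
      let ?c = "complex_of_real t * c"
      have tw: "twist ?c a \<phi> = (\<lambda>x. complex_of_real (1 + t\<^sup>2) * \<phi> x + complex_of_real t * d x)"
      proof
        fix x
        have "?c * cnj ?c = complex_of_real (t\<^sup>2) * (c * cnj c)"
          by (simp add: power2_eq_square)
        then have "?c * cnj ?c = complex_of_real (t\<^sup>2)"
          using c by simp
        then show "twist ?c a \<phi> x = complex_of_real (1 + t\<^sup>2) * \<phi> x + complex_of_real t * d x"
          unfolding twist_def d_def by (simp add: algebra_simps)
      qed
      have "eig (twist ?c a \<phi>)"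
        unfolding eig_def conv_twist[OF f(1) c\<phi>] by (simp add: twist_def \<phi>(2) algebra_simps)
      then have "sqnorm (twist ?c a \<phi>) \<le> s * (Re (twist ?c a \<phi> 0))\<^sup>2"
        using nposdefD(2)[OF \<phi>(1)] by (intro max continuous_twist c\<phi> posdef_twist)
      moreover have "Re (twist ?c a \<phi> 0) = 1 + t\<^sup>2 + t * \<delta>"
        unfolding tw using nposdefD(3)[OF \<phi>(1)] d0 by simp
      moreover have "sqnorm (twist ?c a \<phi>) = (1 + t\<^sup>2)\<^sup>2 * s + 2 * (1 + t\<^sup>2) * t * A + t\<^sup>2 * sqnorm d"
        unfolding tw sqnorm_add[OF c\<phi> cd] s A_def ..
      moreover have "s * (1 + t\<^sup>2 + t * \<delta>)\<^sup>2 = (1 + t\<^sup>2)\<^sup>2 * s + 2 * (1 + t\<^sup>2) * t * (s * \<delta>) + t\<^sup>2 * (s * \<delta>\<^sup>2)"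
        by (simp add: power2_eq_square algebra_simps)
      ultimately have "(1 + t\<^sup>2)\<^sup>2 * s + 2 * (1 + t\<^sup>2) * t * A + t\<^sup>2 * sqnorm d
          \<le> (1 + t\<^sup>2)\<^sup>2 * s + 2 * (1 + t\<^sup>2) * t * (s * \<delta>) + t\<^sup>2 * (s * \<delta>\<^sup>2)"
        by (simp only:)
      then show ?thesis
        unfolding right_diff_distrib by linarith
    qed
    have "A - s * \<delta> = 0"
      using ineq by (rule linear_term_vanishes)
    moreover from this have "sqnorm d \<le> s * \<delta>\<^sup>2"
      using ineq[of 1] by simp
    \<comment> \<open>This is the squared distance of \<open>d\<close> from
      \<open>\<delta> * \<phi>\<close>; with \<open>A = s * \<delta>\<close> and the bound on
      \<open>sqnorm d\<close> it is at most \<open>0\<close>.\<close>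
    moreover have "sqnorm (\<lambda>x. complex_of_real (- \<delta>) * \<phi> x + complex_of_real 1 * d x) =
        (- \<delta>)\<^sup>2 * s + 2 * (- \<delta>) * 1 * A + 1\<^sup>2 * sqnorm d"
      unfolding sqnorm_add[OF c\<phi> cd] s A_def ..
    ultimately have "sqnorm (\<lambda>x. complex_of_real (- \<delta>) * \<phi> x + complex_of_real 1 * d x) \<le> 0"
      by (simp add: power2_eq_square algebra_simps)
    moreover have "continuous_on UNIV (\<lambda>x. complex_of_real (- \<delta>) * \<phi> x + complex_of_real 1 * d x)"
      by (intro continuous_on_add continuous_on_mult_left c\<phi> cd)
    ultimately have "complex_of_real (- \<delta>) * \<phi> x + complex_of_real 1 * d x = 0"
      by (intro sqnorm_eq_zero)
    then have "d x = complex_of_real \<delta> * \<phi> x" by simp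
    then show ?thesis by (simp only: d_def \<delta>_def)
  qed
  \<comment> \<open>The cases \<open>c = 1\<close> and \<open>c = \<i>\<close> of \<open>key\<close>
    give the sum and the difference of \<open>\<phi> (x + a)\<close> and
    \<open>\<phi> (x - a)\<close>.\<close>
  have "\<phi> (x + a) = \<phi> a * \<phi> x" for x a
  proof -
    have 1: "\<phi> (x + a) + \<phi> (x - a) = complex_of_real (2 * Re (\<phi> a)) * \<phi> x"
      using key[of 1 x a] by simp
    have "\<i> * (\<phi> (x + a) - \<phi> (x - a)) = \<i> * (complex_of_real (2 * Im (\<phi> a)) * \<i> * \<phi> x)"
      using key[of \<i> x a] by (simp add: algebra_simps)
    then have 2: "\<phi> (x + a) - \<phi> (x - a) = complex_of_real (2 * Im (\<phi> a)) * \<i> * \<phi> x"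
      by (simp only: mult_cancel_left complex_i_not_zero simp_thms)
    have "2 * \<phi> (x + a) = 2 * ((complex_of_real (Re (\<phi> a)) + \<i> * complex_of_real (Im (\<phi> a))) * \<phi> x)"
      using arg_cong2[OF 1 2, of "(+)"] by (simp add: algebra_simps)
    then show ?thesis by (simp flip: complex_eq)
  qed
  then have "character \<phi>" by (rule posdef_multiplicative_character[OF \<phi>(1)])
  moreover have "mean (\<lambda>y. f y * \<phi> (- y)) \<noteq> 0"
    using \<phi>(2)[of 0] nposdefD(3)[OF \<phi>(1)] \<open>l > 0\<close> by (simp add: conv_def)
  ultimately show ?thesis using that by blast
qed

end

section \<open>The dual group\<close>

lemma character_zero: "character \<gamma> \<Longrightarrow> \<gamma> 0 = 1"
  unfolding character_def
  by (metis add.right_neutral mult_cancel_left2 norm_zero zero_neq_one)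

lemma character_uminus:
  assumes "character \<gamma>" shows "\<gamma> (- x) * \<gamma> x = 1"
proof -
  have "\<gamma> (- x + x) = \<gamma> (- x) * \<gamma> x"
    using assms unfolding character_def by blast
  then show ?thesis using character_zero[OF assms] by simp
qed

lemma character_cnj_mult: "character \<gamma> \<Longrightarrow> \<gamma> x * cnj (\<gamma> x) = 1"
  by (simp add: character_def flip: complex_norm_square)

lemma nsmul_add: "nsmul n (x + y) = nsmul n x + nsmul n y"
  by (simp add: nsmul_def sum.distrib)

lemma nsmul_zero: "nsmul n 0 = 0"
  by (simp add: nsmul_def)

lemma character_nsmul: "character \<gamma> \<Longrightarrow> \<gamma> (nsmul n x) = \<gamma> x ^ n"
  by (induction n) (simp_all add: nsmul_def character_zero, simp add: character_def)

lemma continuous_on_nsmul: "continuous_on UNIV (nsmul n :: 'a::topological_ab_group_add \<Rightarrow> 'a)"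
  unfolding nsmul_def[abs_def] by (intro continuous_on_sum continuous_on_id)

context compact_ab_group
begin

section \<open>Nontrivial characters and roots of characters\<close>

lemma Urysohn_point:
  assumes "closed C" "a \<notin> (C :: 'a set)"
  obtains g :: "'a \<Rightarrow> real" where "continuous_on UNIV g" "\<And>x. g x \<ge> 0" "g a = 1" "\<And>x. x \<in> C \<Longrightarrow> g x = 0"
proof -
  have "compact_space (euclidean :: 'a topology)"
    using compact_UNIV by (simp add: compact_space_def)
  moreover have "Hausdorff_space (euclidean :: 'a topology)"
    unfolding Hausdorff_space_def using hausdorff by (simp add: disjnt_def) blast
  ultimately have "normal_space (euclidean :: 'a topology)"
    using compact_Hausdorff_or_regular_imp_normal_space by blast
  then obtain g where g: "continuous_map euclidean (top_of_set {0..1::real}) g" "g ` C \<subseteq> {0}" "g ` {a} \<subseteq> {1}"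
    using Urysohn_lemma[of "euclidean :: 'a topology" C "{a}" 0 1] assms by (auto simp: disjnt_def)
  have "continuous_on UNIV g" "\<And>x. g x \<in> {0..1}"
    using g(1) by (auto simp: continuous_map_in_subtopology)
  then show ?thesis using that[of g] g(2,3) by auto
qed

lemma autocorr_zero_nonzero:
  assumes "continuous_on UNIV u" "u x \<noteq> 0"
  shows "autocorr u 0 \<noteq> 0"
proof -
  have "sqnorm u > 0" using sqnorm_eq_zero[OF assms(1)] assms(2) by (meson not_le)
  then show ?thesis by (auto simp: sqnorm_def autocorr_def)
qed

text \<open>With \<open>u\<close> the difference of a translate of \<open>g\<close> and
  \<open>g\<close>, the autocorrelation of \<open>u\<close> is \<open>h (x + a) - h x\<close> for
  the correlation \<open>h\<close> of \<open>g\<close> with \<open>u\<close>. Its mean vanishes, so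
  the trivial character does not occur in it, and the one found by \<open>character_exists\<close>
  is nontrivial.\<close>

lemma nontrivial_character_exists:
  assumes "a \<noteq> (0 :: 'a)"
  obtains \<gamma> :: "'a \<Rightarrow> complex" where "character \<gamma>" "\<gamma> \<noteq> (\<lambda>_. 1)"
proof -
  obtain g0 :: "'a \<Rightarrow> real" where g0: "continuous_on UNIV g0" "g0 0 = 1" "g0 a = 0"
    using Urysohn_point[of "{a}" 0] assms by auto
  define g where "g x = complex_of_real (g0 x)" for x
  have g: "continuous_on UNIV g"
    unfolding g_def[abs_def] by (intro continuous_intros g0)
  define u where "u x = g (x + a) - g x" for x
  have u: "continuous_on UNIV u"
    unfolding u_def[abs_def] by (intro continuous_on_diff continuous_translate g)
  have "u 0 \<noteq> 0" using g0 by (simp add: u_def g_def)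
  then obtain \<gamma> where \<gamma>: "character \<gamma>" "mean (\<lambda>y. autocorr u y * \<gamma> (- y)) \<noteq> 0"
    using character_exists[OF continuous_autocorr[OF u] posdef_autocorr[OF u] autocorr_zero_nonzero[OF u]]
    by blast
  define h where "h x = mean (\<lambda>z. g (z + x) * cnj (u z))" for x
  have "continuous_on UNIV (\<lambda>(x, z). g (z + x) * cnj (u z))"
    unfolding split_beta
    by (intro continuous_on_mult continuous_on_cnj continuous_on_compose2[OF g] continuous_on_compose2[OF u]
        continuous_on_add continuous_on_fst continuous_on_snd continuous_on_id) auto
  then have h: "continuous_on UNIV h"
    unfolding h_def[abs_def] by (rule continuous_mean)
  have "autocorr u x = h (x + a) - h x" for x
  proof -
    have "autocorr u x = mean (\<lambda>z. g (z + (x + a)) * cnj (u z) - g (z + x) * cnj (u z))"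
      using autocorr_diff[OF u, of x 0] by (simp add: u_def[of "_ + _"] left_diff_distrib add.assoc)
    also have "\<dots> = h (x + a) - h x"
      unfolding h_def by (intro mean_diff continuous_on_mult continuous_on_cnj continuous_translate g u)
    finally show ?thesis .
  qed
  then have "mean (autocorr u) = mean (\<lambda>x. h (x + a) - h x)"
    by (intro arg_cong[where f = mean]) auto
  also have "\<dots> = 0"
    by (simp add: mean_diff h continuous_translate mean_translate)
  finally have "mean (autocorr u) = 0" .
  then have "\<gamma> \<noteq> (\<lambda>_. 1)" using \<gamma>(2) by auto
  then show ?thesis using that \<gamma>(1) by blast
qed

text \<open>The function \<open>u\<close>, and then its autocorrelation \<open>f\<close>, is
  multiplied by \<open>\<gamma> x\<close> under translation by \<open>nsmul n x\<close>. Invariance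
  of the mean allows a nonzero coefficient at \<open>\<psi>\<close> only if
  \<open>\<psi> (nsmul n x) = \<gamma> x\<close>.\<close>

lemma character_root_exists:
  assumes tf: "torsion_free TYPE('a)" and "n > 0" and \<gamma>: "character (\<gamma> :: 'a \<Rightarrow> complex)"
  obtains \<psi> where "character \<psi>" "\<And>x. \<psi> x ^ n = \<gamma> x"
proof -
  have c\<gamma>: "continuous_on UNIV \<gamma>" using \<gamma> by (simp add: character_def)
  \<comment> \<open>\<open>g\<close> will vanish on \<open>C\<close>, so that the integrand defining
    \<open>u 0\<close> has nonnegative real part everywhere. Torsion-freeness keeps \<open>0\<close>
    out of \<open>C\<close>, which allows \<open>g 0 = 1\<close>.\<close>
  define C where "C = nsmul n ` {x. Re (\<gamma> x) \<le> 0}"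
  have "closed {x. Re (\<gamma> x) \<le> 0}"
    by (intro closed_Collect_le continuous_intros c\<gamma>)
  then have "compact {x. Re (\<gamma> x) \<le> 0}"
    using compact_Int_closed[OF compact_UNIV] by simp
  then have "compact C"
    unfolding C_def by (intro compact_continuous_image continuous_on_subset[OF continuous_on_nsmul]) auto
  then have "closed C" by (rule compact_imp_closed)
  moreover have "0 \<notin> C"
  proof
    assume "0 \<in> C"
    then obtain x where "nsmul n x = 0" "Re (\<gamma> x) \<le> 0" by (auto simp: C_def)
    with tf \<open>n > 0\<close> have "x = 0" unfolding torsion_free_def by blast
    with \<open>Re (\<gamma> x) \<le> 0\<close> show False using character_zero[OF \<gamma>] by simp
  qed
  ultimately obtain g0 :: "'a \<Rightarrow> real" where g0: "continuous_on UNIV g0" "\<And>x. g0 x \<ge> 0" "g0 0 = 1"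
      "\<And>x. x \<in> C \<Longrightarrow> g0 x = 0"
    using Urysohn_point by blast
  define g where "g x = complex_of_real (g0 x)" for x
  have g: "continuous_on UNIV g"
    unfolding g_def[abs_def] by (intro continuous_intros g0)
  define u where "u y = mean (\<lambda>x. g (y + nsmul n x) * cnj (\<gamma> x))" for y
  have cu2: "continuous_on UNIV (\<lambda>(y, x). g (y + nsmul n x) * cnj (\<gamma> x))"
    unfolding split_beta
    by (intro continuous_on_mult continuous_on_cnj continuous_on_compose2[OF g] continuous_on_compose2[OF c\<gamma>]
        continuous_on_compose2[OF continuous_on_nsmul]
        continuous_on_add continuous_on_fst continuous_on_snd continuous_on_id) auto
  then have u: "continuous_on UNIV u"
    unfolding u_def[abs_def] by (rule continuous_mean)
  have cu: "continuous_on UNIV (\<lambda>x. g (y + nsmul n x) * cnj (\<gamma> x))" for y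
    by (intro continuous_on_mult continuous_on_cnj c\<gamma> continuous_on_compose2[OF g]
        continuous_on_add continuous_on_const continuous_on_nsmul) auto
  have "0 < Re (u 0)"
    unfolding u_def
  proof (rule Re_mean_pos[OF cu, of _ 0])
    fix x
    show "0 \<le> Re (g (0 + nsmul n x) * cnj (\<gamma> x))"
    proof (cases "Re (\<gamma> x) \<le> 0")
      case True
      then have "nsmul n x \<in> C" by (auto simp: C_def)
      then show ?thesis by (simp add: g_def g0(4))
    next
      case False
      then show ?thesis using g0(2)[of "nsmul n x"] by (simp add: g_def)
    qed
  qed (simp add: nsmul_zero g_def g0(3) character_zero[OF \<gamma>])
  then have "u 0 \<noteq> 0" by auto
  have ush: "u (y + nsmul n x) = \<gamma> x * u y" for x y
  proof -
    let ?F = "\<lambda>z. g (y + nsmul n z) * cnj (\<gamma> z)"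
    have "g (y + nsmul n x + nsmul n z) * cnj (\<gamma> z) = \<gamma> x * ?F (z + x)" for z
    proof -
      have "\<gamma> x * ?F (z + x) = g (y + nsmul n (z + x)) * (cnj (\<gamma> z) * (\<gamma> x * cnj (\<gamma> x)))"
        using \<gamma> by (simp add: character_def mult_ac)
      moreover have "y + nsmul n x + nsmul n z = y + nsmul n (z + x)"
        by (simp add: nsmul_add add_ac)
      ultimately show ?thesis
        by (simp only: character_cnj_mult[OF \<gamma>] mult_1_right)
    qed
    then have "u (y + nsmul n x) = mean (\<lambda>z. \<gamma> x * ?F (z + x))"
      by (simp add: u_def)
    also have "\<dots> = \<gamma> x * mean ?F"
      by (simp only: mean_cmult[OF continuous_translate[OF cu]] mean_translate[OF cu])
    finally show ?thesis by (simp add: u_def)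
  qed
  define f where "f = autocorr u"
  have f: "continuous_on UNIV f" "posdef f" "f 0 \<noteq> 0"
    using u \<open>u 0 \<noteq> 0\<close> by (auto simp: f_def continuous_autocorr posdef_autocorr autocorr_zero_nonzero)
  have fsh: "f (y + nsmul n x) = \<gamma> x * f y" for x y
  proof -
    have "u (y + nsmul n x + z) * cnj (u z) = \<gamma> x * (u (z + y) * cnj (u z))" for z
      using ush[of "z + y" x] by (simp add: add_ac)
    then have "f (y + nsmul n x) = mean (\<lambda>z. \<gamma> x * (u (z + y) * cnj (u z)))"
      by (simp only: f_def autocorr_def)
    also have "\<dots> = \<gamma> x * mean (\<lambda>z. u (z + y) * cnj (u z))"
      by (intro mean_cmult continuous_on_mult continuous_on_cnj continuous_translate u)
    finally show ?thesis by (simp add: f_def autocorr_def add.commute)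
  qed
  obtain \<psi> where \<psi>: "character \<psi>" "mean (\<lambda>y. f y * \<psi> (- y)) \<noteq> 0"
    using character_exists[OF f] by blast
  have "\<psi> x ^ n = \<gamma> x" for x
  proof -
    let ?F = "\<lambda>y. f y * \<psi> (- y)"
    have c\<psi>: "continuous_on UNIV \<psi>" using \<psi>(1) by (simp add: character_def)
    have cF: "continuous_on UNIV ?F"
      using continuous_reflect[OF c\<psi>, of 0] f(1) by (simp add: continuous_on_mult)
    have "?F (y + nsmul n x) = (\<gamma> x * \<psi> (- nsmul n x)) * ?F y" for y
    proof -
      have "\<psi> (- (y + nsmul n x)) = \<psi> (- nsmul n x) * \<psi> (- y)"
        using \<psi>(1) unfolding character_def minus_add by blast
      then show ?thesis by (simp only: fsh mult_ac)
    qed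
    then have "mean (\<lambda>y. ?F (y + nsmul n x)) = (\<gamma> x * \<psi> (- nsmul n x)) * mean ?F"
      by (simp only: mean_cmult[OF cF])
    then have "\<gamma> x * \<psi> (- nsmul n x) = 1"
      using \<psi>(2) by (simp only: mean_translate[OF cF]) auto
    then have "\<psi> (nsmul n x) = \<gamma> x"
      using character_uminus[OF \<psi>(1), of "nsmul n x"]
      by (metis mult.commute mult.left_neutral mult.assoc)
    then show ?thesis by (simp add: character_nsmul[OF \<psi>(1)])
  qed
  then show ?thesis using that \<psi>(1) by blast
qed

text \<open>A divisible group has no proper subgroup of finite index: with \<open>N\<close> the
  number of cosets, each element has a root of order \<open>fact N\<close>, and some power of this
  root with exponent dividing \<open>fact N\<close> lies in \<open>H\<close>.\<close>

lemma finite_index_dual_subgroup: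
  assumes tf: "torsion_free TYPE('a)" and H: "dual_subgroup (H :: ('a \<Rightarrow> complex) set)" "finite_index H"
  shows "H = dual_group"
proof
  show "H \<subseteq> dual_group" using H(1) by (simp add: dual_subgroup_def)
  show "dual_group \<subseteq> H"
  proof
    fix \<eta> :: "'a \<Rightarrow> complex" assume "\<eta> \<in> dual_group"
    define N where "N = card ((\<lambda>\<gamma>. dual_coset \<gamma> H) ` dual_group)"
    obtain \<psi> where \<psi>: "character \<psi>" "\<And>x. \<psi> x ^ fact N = \<eta> x"
      using character_root_exists[OF tf, of "fact N" \<eta>] \<open>\<eta> \<in> dual_group\<close>
      by (auto simp: dual_group_def)
    define p where "p i = (\<lambda>x. \<psi> x ^ i)" for i
    have p: "p i \<in> dual_group" for i
      using \<psi>(1) by (auto simp: dual_group_def character_def p_def norm_power power_mult_distrib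
          intro: continuous_on_power)
    \<comment> \<open>Pigeonhole: the \<open>N + 1\<close> powers \<open>p 0\<close> to
      \<open>p N\<close> represent at most \<open>N\<close> cosets. Two that share a coset differ by
      a power \<open>p k\<close> in \<open>H\<close> with \<open>0 < k \<le> N\<close>, and every
      such \<open>k\<close> divides \<open>fact N\<close>.\<close>
    have "card ((\<lambda>i. dual_coset (p i) H) ` {..N}) \<le> N"
      unfolding N_def using p H(2) by (intro card_mono) (auto simp: finite_index_def)
    then have "\<not> inj_on (\<lambda>i. dual_coset (p i) H) {..N}"
      using card_image[of "\<lambda>i. dual_coset (p i) H" "{..N}"] by auto
    then obtain i j where ij: "i \<noteq> j" "i \<le> N" "j \<le> N" "dual_coset (p i) H = dual_coset (p j) H"
      by (auto simp: inj_on_def)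
    have "\<exists>k. 0 < k \<and> k \<le> N \<and> p k \<in> H"
      if "i < j" "j \<le> N" and eq: "dual_coset (p i) H = dual_coset (p j) H" for i j
    proof -
      have "p j \<in> dual_coset (p j) H"
        using H(1) by (auto simp: dual_coset_def dual_subgroup_def intro!: image_eqI[of _ _ "\<lambda>_. 1"])
      then have "p j \<in> dual_coset (p i) H" by (simp only: eq)
      then obtain h where h: "h \<in> H" "p j = (\<lambda>x. p i x * h x)"
        unfolding dual_coset_def by (rule imageE)
      have "h x = p (j - i) x" for x
      proof -
        have "\<psi> x \<noteq> 0" using \<psi>(1) unfolding character_def by (metis norm_zero zero_neq_one)
        moreover have "\<psi> x ^ i * \<psi> x ^ (j - i) = \<psi> x ^ i * h x"
          using fun_cong[OF h(2), of x] \<open>i < j\<close> by (simp add: p_def flip: power_add)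
        ultimately show ?thesis by (simp add: p_def)
      qed
      then have "h = p (j - i)" by blast
      then show ?thesis using h(1) that(1,2) by (intro exI[of _ "j - i"]) auto
    qed
    then obtain k where k: "0 < k" "k \<le> N" "p k \<in> H"
      using ij by (metis nat_neq_iff)
    have pw: "(\<lambda>x. p k x ^ m) \<in> H" for m
    proof (induction m)
      case 0
      then show ?case using H(1) by (simp add: dual_subgroup_def)
    next
      case (Suc m)
      then show ?case using H(1) k(3) by (simp add: dual_subgroup_def)
    qed
    have "k dvd fact N" using k(1,2) by (simp add: dvd_fact)
    then obtain m where "fact N = k * m" by blast
    then have "\<eta> = (\<lambda>x. p k x ^ m)"
      by (auto simp: p_def fun_eq_iff simp flip: power_mult \<psi>(2))
    then show "\<eta> \<in> H" using pw by simp
  qed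
qed

text \<open>In a finite dual the trivial subgroup would have finite index and hence be the whole
  dual, which contains a nontrivial character.\<close>

lemma infinite_dual_group:
  assumes tf: "torsion_free TYPE('a)" and "a \<noteq> (0 :: 'a)"
  shows "infinite (dual_group :: ('a \<Rightarrow> complex) set)"
proof
  assume "finite (dual_group :: ('a \<Rightarrow> complex) set)"
  then have "finite_index {\<lambda>_ :: 'a. 1 :: complex}"
    by (simp add: finite_index_def)
  moreover have "dual_subgroup {\<lambda>_ :: 'a. 1 :: complex}"
    by (auto simp: dual_subgroup_def dual_group_def character_def)
  ultimately have "dual_group = {\<lambda>_ :: 'a. 1 :: complex}"
    using finite_index_dual_subgroup[OF tf] by metis
  moreover obtain \<gamma> :: "'a \<Rightarrow> complex" where "character \<gamma>" "\<gamma> \<noteq> (\<lambda>_. 1)"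
    using nontrivial_character_exists[OF assms(2)] by blast
  ultimately show False by (auto simp: dual_group_def)
qed

end

lemma dual_coset_dual_group:
  assumes "\<gamma> \<in> dual_group" "\<kappa> \<in> dual_group"
  shows "\<kappa> \<in> dual_coset \<gamma> dual_group"
proof -
  have \<gamma>: "character \<gamma>" and \<kappa>: "character \<kappa>" using assms by (auto simp: dual_group_def)
  have "(\<lambda>x. cnj (\<gamma> x) * \<kappa> x) \<in> dual_group"
    using \<gamma> \<kappa> by (auto simp: dual_group_def character_def norm_mult intro!: continuous_on_mult continuous_on_cnj)
  then have "(\<lambda>x. \<gamma> x * (cnj (\<gamma> x) * \<kappa> x)) \<in> dual_coset \<gamma> dual_group"
    unfolding dual_coset_def by (rule imageI)
  then show ?thesis
    by (simp add: character_cnj_mult[OF \<gamma>] flip: mult.assoc)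
qed

text \<open>Starting from the constant \<open>1\<close>, each \<open>\<gamma>\<close> in
  \<open>K\<close> contributes a factor \<open>\<xi> a - \<gamma> a\<close> with \<open>a\<close>
  chosen such that \<open>\<kappa> a \<noteq> \<gamma> a\<close>.\<close>

lemma trig_poly_separating:
  assumes "finite K" "K \<subseteq> dual_group" "\<kappa> \<in> dual_group" "\<kappa> \<notin> K"
  shows "\<exists>xs. (\<forall>\<gamma>\<in>K. trig_poly xs \<gamma> = 0) \<and> trig_poly xs \<kappa> \<noteq> 0"
  using assms
proof (induction K)
  case empty
  have "trig_poly [(0, 1)] \<kappa> \<noteq> 0"
    using empty(2) character_zero[of \<kappa>] by (simp add: trig_poly_def dual_group_def)
  then show ?case by blast
next
  case (insert \<gamma> K)
  then obtain xs where xs: "\<forall>\<gamma>\<in>K. trig_poly xs \<gamma> = 0" "trig_poly xs \<kappa> \<noteq> 0" by auto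
  obtain a where a: "\<kappa> a \<noteq> \<gamma> a" using insert.prems(3) by (metis ext insertI1)
  \<comment> \<open>Multiplication by \<open>\<xi> a - \<gamma> a\<close> on coefficient lists:
    since \<open>\<xi> x * \<xi> a = \<xi> (x + a)\<close> for a character, the factor
    \<open>\<xi> a\<close> shifts the points, while \<open>- \<gamma> a\<close> scales the
    coefficients.\<close>
  define ys where "ys = map (\<lambda>(x, c). (x + a, c)) xs @ map (\<lambda>(x, c). (x, - c * \<gamma> a)) xs"
  have "trig_poly ys \<xi> = trig_poly xs \<xi> * (\<xi> a - \<gamma> a)" if "\<xi> \<in> dual_group" for \<xi>
  proof -
    have "\<xi> (x + a) = \<xi> x * \<xi> a" for x using that by (simp add: dual_group_def character_def)
    then show ?thesis
      unfolding ys_def trig_poly_def by (induction xs) (auto simp: algebra_simps)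
  qed
  then have "(\<forall>\<gamma>\<in>insert \<gamma> K. trig_poly ys \<gamma> = 0) \<and> trig_poly ys \<kappa> \<noteq> 0"
    using insert.prems xs a by auto
  then show ?case by blast
qed

theorem theorem2p9:
  assumes "compact (UNIV :: ('a::{topological_ab_group_add, t2_space}) set)"
    and "torsion_free TYPE('a)"
    and "\<exists>x::'a. x \<noteq> 0"
  shows "(\<forall>K \<subseteq> (dual_group :: ('a \<Rightarrow> complex) set). K \<noteq> {} \<longrightarrow> ubiquitous K) \<and>
         (\<forall>K \<subseteq> (dual_group :: ('a \<Rightarrow> complex) set). finite K \<longrightarrow> \<not> strictly_pos_def K)"
proof -
  interpret compact_ab_group "TYPE('a)"
    by unfold_locales (rule assms(1))
  have "ubiquitous K" if "K \<subseteq> dual_group" "K \<noteq> {}" for K :: "('a \<Rightarrow> complex) set"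
    unfolding ubiquitous_def
  proof (intro allI impI ballI)
    fix H :: "('a \<Rightarrow> complex) set" and \<gamma> :: "'a \<Rightarrow> complex"
    assume "dual_subgroup H \<and> finite_index H" and \<gamma>: "\<gamma> \<in> dual_group"
    then have "H = dual_group" using finite_index_dual_subgroup[OF assms(2)] by blast
    then show "dual_coset \<gamma> H \<inter> K \<noteq> {}"
      using that dual_coset_dual_group[OF \<gamma>] by blast
  qed
  moreover have "\<not> strictly_pos_def K" if K: "K \<subseteq> dual_group" "finite K" for K :: "('a \<Rightarrow> complex) set"
  proof -
    have "infinite (dual_group :: ('a \<Rightarrow> complex) set)"
      using infinite_dual_group[OF assms(2)] assms(3) by blast
    then obtain \<kappa> :: "'a \<Rightarrow> complex" where \<kappa>: "\<kappa> \<in> dual_group" "\<kappa> \<notin> K"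
      using K(2) by (meson finite_subset subsetI)
    then show ?thesis
      using trig_poly_separating[OF K(2,1) \<kappa>] unfolding strictly_pos_def_def by blast
  qed
  ultimately show ?thesis by blast
qed

end
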